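(* Let $d\ge2$, let $\beta$ and $X$ be independent random vectors in $\mathbb S^{d-1}$, where $\beta$ has a probability density $f_\beta\in\mathrm L^2(\mathbb S^{d-1})$ with respect to $\sigma$ and $X$ has a density $f_X$ with respect to $\sigma$ that is positive $\sigma$-a.e. on $H^+$ and zero outside $H^+$. Let $Y=\mathbb I\{X'\beta\ge0\}$, $r(x)=\mathbb P(Y=1\mid X=x)$ for $x\in H^+$, and $R(x)=r(x)$ for $x_1\ge0$, $R(x)=1-r(-x)$ for $x_1<0$. Then for each $p$ the expectation $\mathbb E\big[\frac{(2Y-1)}{f_X(X)}q_{2p+1,d}(X,x)\big]$ equals $Q_{2p+1,d}R(x)$, and $$R(x)=\frac12+\sum_{p=0}^\infty\mathbb E\Big[\frac{(2Y-1)}{f_X(X)}\,q_{2p+1,d}(X,x)\Big],$$ the series converging in $\mathrm L^2(\mathbb S^{d-1})$.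
   Context: $\mathbb S^{d-1}$ is the unit sphere in $\mathbb R^d$ with surface measure $\sigma$, $|\mathbb S^{d-1}|=2\pi^{d/2}/\Gamma(d/2)$; $H^+=\{x\in\mathbb S^{d-1}:x_1\ge0\}$. $H^{n,d}$ is the space of restrictions to $\mathbb S^{d-1}$ of homogeneous harmonic polynomials of degree $n$ on $\mathbb R^d$, of dimension $h(n,d)=\frac{(2n+d-2)(n+d-2)!}{n!(d-2)!(n+d-2)}$ ($h(0,d)=1$, $h(n,2)=2$ for $n\ge1$); $Q_{n,d}$ is the orthogonal projector of $\mathrm L^2(\mathbb S^{d-1})$ onto $H^{n,d}$, the integral operator with kernel $q_{n,d}(x,y)=\frac{h(n,d)C_n^{\nu(d)}(x'y)}{|\mathbb S^{d-1}|C_n^{\nu(d)}(1)}$, $\nu(d)=(d-2)/2$, where $C_n^\nu$ are the Gegenbauer polynomials ($C_n^\nu(t)=\sum_{l=0}^{\lfloor n/2\rfloor}\frac{(-1)^l(\nu)_{n-l}}{l!(n-2l)!}(2t)^{n-2l}$ for $\nu>0$; $C_0^0=1$, $C_n^0(t)=\frac2n\cos(n\arccos t)$ for $n\ge1$). *)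

theory Defs
  imports "HOL-Probability.Probability"
begin

text \<open>Surface measure on the unit sphere of real^'n, via the cone construction:
  sigma(A) = d * lambda({t x : x in A, 0 < t < 1}), d = CARD('n).\<close>
definition sphere_measure :: "(real^'n) measure" where
  "sphere_measure = scale_measure (of_nat CARD('n))
     (distr (restrict_space lborel (ball 0 1 - {0})) (restrict_space borel (sphere 0 1))
        (\<lambda>x. x /\<^sub>R norm x))"

definition sphere_area :: "nat \<Rightarrow> real" where
  "sphere_area d = 2 * pi powr (real d / 2) / Gamma (real d / 2)"

text \<open>Dimension h(n,d) of the space of spherical harmonics of degree n.\<close>
definition harm_dim :: "nat \<Rightarrow> nat \<Rightarrow> real" where
  "harm_dim n d = (if n = 0 then 1 else
     real (2*n + d - 2) * fact (n + d - 2) / (fact n * fact (d - 2) * real (n + d - 2)))"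

definition gegenbauer :: "real \<Rightarrow> nat \<Rightarrow> real \<Rightarrow> real" where
  "gegenbauer \<nu> n t = (if \<nu> = 0 then (if n = 0 then 1 else 2 / real n * cos (real n * arccos t))
     else (\<Sum>l\<le>n div 2. (-1) ^ l * pochhammer \<nu> (n - l) / (fact l * fact (n - 2*l)) * (2*t) ^ (n - 2*l)))"

definition gnu :: "nat \<Rightarrow> real" where
  "gnu d = (real d - 2) / 2"

text \<open>Reproducing kernel q_{n,d}(x,y) of the projector onto H^{n,d}.\<close>
definition qker :: "nat \<Rightarrow> nat \<Rightarrow> real^'n \<Rightarrow> real^'n \<Rightarrow> real" where
  "qker n d x y = harm_dim n d * gegenbauer (gnu d) n (x \<bullet> y)
                  / (sphere_area d * gegenbauer (gnu d) n 1)"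

definition Qproj :: "nat \<Rightarrow> (real^'n \<Rightarrow> real) \<Rightarrow> real^'n \<Rightarrow> real" where
  "Qproj n f x = (\<integral>y. qker n CARD('n) x y * f y \<partial>sphere_measure)"

text \<open>Hemisphere H^+ = {x in sphere : x_1 >= 0}; the "first" coordinate is the index e.\<close>
definition hemi :: "'n \<Rightarrow> (real^'n) set" where
  "hemi e = {x \<in> sphere 0 1. x $ e \<ge> 0}"

end

theory Submission
  imports Defs
begin

text \<open>Up to a null set, \<open>R\<close> is the hemispherical transform
  \<open>H x = P(x \<bullet> \<beta> \<ge> 0) = \<integral> f\<beta> b over {b. x \<bullet> b \<ge> 0}\<close>, which is continuous and satisfies
  \<open>H (- x) = 1 - H x\<close>.  Integrating out the joint law of \<open>(\<beta>, X)\<close>, the weight \<open>1 / fX\<close> cancels and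
  the expectation becomes the integral of \<open>(2 H - 1) q\<close> over the hemisphere; for odd degree the
  integrand is even, so this is the projection of \<open>H\<close>.  It remains to see that the projections
  of the odd continuous function \<open>H - 1/2\<close> sum to it in \<open>L2\<close>.

  For this, the kernels \<open>q n\<close> are the coefficients of the Poisson kernel
  \<open>(1 - r^2) / (|S| (1 - 2 r t + r^2)^(d/2))\<close> in powers of \<open>r\<close>, by the generating function of the
  Gegenbauer polynomials.  Kernels of different degrees are orthogonal because of the Gegenbauer
  differential equation and the skew-symmetry of the generators of rotations.  Since the Poisson
  kernel is an approximate identity, letting \<open>r\<close> tend to 1 shows that each projection is
  idempotent and that Bessel's inequality is an equality for continuous functions.\<close>

section \<open>Gegenbauer polynomials\<close>

text \<open>The spaces of harmonic polynomials are never constructed. Only their kernels enter, so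
  orthogonality, idempotence and completeness must be drawn from one-variable polynomials and from
  three facts about the measure: rotation invariance, total mass, and nullity of great spheres. The
  awkward case is dimension two, where \<nu> = 0 and \<open>gegenbauer 0 n\<close> is a cosine given
  by a separate clause. Passing to the parameter \<nu> + 1 removes the distinction: (1 - 2rt +
  r^2)^(-(\<nu>+1)) generates C_n^(\<nu>+1), and multiplication by 1 - r^2 replaces these by
  C_n^(\<nu>+1) - C_(n-2)^(\<nu>+1). Since \<nu> + 1 = d/2, the result is exactly the Poisson kernel
  up to the area, and \<open>harm_dim\<close> is the constant that turns the normalised Gegenbauer
  polynomial into this difference. Partial sums of the expansion are hard to control directly. Abel
  means are integrals against a nonnegative kernel of mass one, and the passage back to partial sums
  works because the Parseval terms are nonnegative.\<close>

definition gcoef :: "real \<Rightarrow> nat \<Rightarrow> nat \<Rightarrow> real" where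
  "gcoef \<nu> n l = (if 2 * l \<le> n
     then (-1) ^ l * pochhammer \<nu> (n - l) / (fact l * fact (n - 2 * l)) else 0)"

section \<open>Coefficients and the three-term recurrence\<close>

text \<open>Coefficients beyond \<open>n div 2\<close> are zero, so polynomials of different degrees
  can be compared over one common range. Without that guard, the truncated subtraction in
  \<open>n - 2 * l\<close> would produce spurious constant terms.\<close>

lemma gegenbauer_eq_sum:
  assumes "\<nu> \<noteq> 0" "n \<le> N"
  shows "gegenbauer \<nu> n t = (\<Sum>l\<le>N. gcoef \<nu> n l * (2 * t) ^ (n - 2 * l))"
proof -
  have "(\<Sum>l\<le>N. gcoef \<nu> n l * (2 * t) ^ (n - 2 * l)) =
        (\<Sum>l\<le>n div 2. gcoef \<nu> n l * (2 * t) ^ (n - 2 * l))"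
    using assms(2) by (intro sum.mono_neutral_right) (auto simp: gcoef_def)
  also have "\<dots> = gegenbauer \<nu> n t"
    using assms(1) by (auto simp: gegenbauer_def gcoef_def intro!: sum.cong)
  finally show ?thesis by simp
qed

lemma gcoef_rec_0:
  "real (n + 2) * gcoef \<nu> (n + 2) 0 = (real (n + 1) + \<nu>) * gcoef \<nu> (n + 1) 0"
proof -
  have "pochhammer \<nu> (n + 2) = pochhammer \<nu> (n + 1) * (\<nu> + real (n + 1))"
    using pochhammer_Suc[of \<nu> "n + 1"] by simp
  moreover have "(fact (n + 2) :: real) = real (n + 2) * fact (n + 1)"
    by simp
  ultimately show ?thesis
    unfolding gcoef_def by (simp del: fact_Suc of_nat_add of_nat_Suc)
qed

text \<open>The recurrence read off at one power of \<open>2 * t\<close>. Multiplication by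
  \<open>2 * t\<close> keeps the index of a coefficient, whereas going from degree
  \<open>n + 2\<close> to \<open>n\<close> shifts it by one. All three coefficients are rational
  multiples of the same quantity \<open>Q\<close>.\<close>

lemma gcoef_rec_Suc:
  "real (n + 2) * gcoef \<nu> (n + 2) (Suc k) =
     (real (n + 1) + \<nu>) * gcoef \<nu> (n + 1) (Suc k) - (real n + 2 * \<nu>) * gcoef \<nu> n k"
proof (cases "2 * k \<le> n")
  case False
  then show ?thesis by (simp add: gcoef_def)
next
  case True
  then obtain m where n: "n = 2 * k + m"
    using le_Suc_ex by blast
  have p: "pochhammer \<nu> (Suc (k + m)) = pochhammer \<nu> (k + m) * (\<nu> + real (k + m))"
    by (rule pochhammer_Suc)
  have e: "n - k = k + m" "n + 1 - Suc k = k + m" "n + 2 - Suc k = Suc (k + m)"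
    "n - 2 * k = m" "n + 2 - 2 * Suc k = m" using n by auto
  define Q where "Q = (-1) ^ k * pochhammer \<nu> (k + m) / (fact k * fact m)"
  have 0: "gcoef \<nu> n k = Q"
    using n unfolding gcoef_def e Q_def by simp
  \<comment> \<open>For \<open>m = 0\<close> the index \<open>Suc k\<close> is out of range in
    degree \<open>n + 1\<close>; the factor \<open>real m\<close> makes the formula correct there
    too.\<close>
  have 1: "gcoef \<nu> (n + 1) (Suc k) = - Q * real m / real (Suc k)"
  proof (cases m)
    case (Suc j)
    have e': "n + 1 - 2 * Suc k = j" using n Suc by auto
    have "(fact m :: real) = real m * fact j" using Suc by simp
    then show ?thesis
      using n Suc unfolding gcoef_def e e' Q_def by (simp del: of_nat_Suc)
  qed (use n in \<open>simp add: gcoef_def\<close>)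
  have 2: "gcoef \<nu> (n + 2) (Suc k) = - Q * (\<nu> + real (k + m)) / real (Suc k)"
    using n unfolding gcoef_def e p Q_def by (simp add: mult_ac del: of_nat_Suc)
  show ?thesis
    unfolding 0 1 2 unfolding n by (simp add: divide_simps) (simp add: algebra_simps)
qed

lemma gegenbauer_rec:
  assumes "\<nu> \<noteq> 0"
  shows "real (n + 2) * gegenbauer \<nu> (n + 2) t =
    2 * t * (real (n + 1) + \<nu>) * gegenbauer \<nu> (n + 1) t - (real n + 2 * \<nu>) * gegenbauer \<nu> n t"
proof -
  let ?T = "2 * t"
  \<comment> \<open>Raising the exponent by one under truncated subtraction fails only where the
    coefficient vanishes. The upper limit \<open>Suc (n + 1)\<close> lets the term of index 0 be
    split off, leaving the range of the sum for degree \<open>n\<close>.\<close>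
  have 1: "?T * gegenbauer \<nu> (n + 1) t = (\<Sum>l\<le>Suc (n + 1). gcoef \<nu> (n + 1) l * ?T ^ (n + 2 - 2 * l))"
    unfolding gegenbauer_eq_sum[OF assms le_SucI[OF order_refl], of "n + 1"] sum_distrib_left
  proof (rule sum.cong[OF refl])
    fix l
    show "?T * (gcoef \<nu> (n + 1) l * ?T ^ (n + 1 - 2 * l)) = gcoef \<nu> (n + 1) l * ?T ^ (n + 2 - 2 * l)"
    proof (cases "2 * l \<le> n + 1")
      case True
      then have "n + 2 - 2 * l = Suc (n + 1 - 2 * l)" by simp
      then show ?thesis by simp
    qed (simp add: gcoef_def)
  qed
  have 2: "gegenbauer \<nu> (n + 2) t = gcoef \<nu> (n + 2) 0 * ?T ^ (n + 2)
      + (\<Sum>k\<le>n + 1. gcoef \<nu> (n + 2) (Suc k) * ?T ^ (n - 2 * k))"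
    using gegenbauer_eq_sum[OF assms, of "n + 2" "Suc (n + 1)" t]
    unfolding sum.atMost_Suc_shift[of _ "n + 1"] by simp
  have 3: "?T * gegenbauer \<nu> (n + 1) t = gcoef \<nu> (n + 1) 0 * ?T ^ (n + 2)
      + (\<Sum>k\<le>n + 1. gcoef \<nu> (n + 1) (Suc k) * ?T ^ (n - 2 * k))"
    unfolding 1 sum.atMost_Suc_shift[of _ "n + 1"] by simp
  have 4: "(real n + 2 * \<nu>) * gegenbauer \<nu> n t
     = (\<Sum>k\<le>n + 1. (real n + 2 * \<nu>) * gcoef \<nu> n k * ?T ^ (n - 2 * k))"
    by (subst gegenbauer_eq_sum[OF assms, of n "n + 1"])
       (simp_all only: sum_distrib_left mult.assoc)
  have 5: "real (n + 2) * (\<Sum>k\<le>n + 1. gcoef \<nu> (n + 2) (Suc k) * ?T ^ (n - 2 * k)) =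
     (real (n + 1) + \<nu>) * (\<Sum>k\<le>n + 1. gcoef \<nu> (n + 1) (Suc k) * ?T ^ (n - 2 * k))
     - (real n + 2 * \<nu>) * gegenbauer \<nu> n t"
    unfolding 4 sum_distrib_left sum_subtractf[symmetric]
    by (intro sum.cong refl) (simp only: gcoef_rec_Suc left_diff_distrib mult.assoc[symmetric])
  have "real (n + 2) * gegenbauer \<nu> (n + 2) t =
      (real (n + 1) + \<nu>) * (?T * gegenbauer \<nu> (n + 1) t) - (real n + 2 * \<nu>) * gegenbauer \<nu> n t"
    unfolding 2 3 distrib_left 5 mult.assoc[symmetric] gcoef_rec_0 by (simp only: add_diff_eq)
  then show ?thesis by (simp only: mult_ac)
qed

lemma gegenbauer_0 [simp]: "gegenbauer \<nu> 0 t = 1"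
  by (simp add: gegenbauer_def)

lemma gegenbauer_1: "\<nu> \<noteq> 0 \<Longrightarrow> gegenbauer \<nu> (Suc 0) t = 2 * \<nu> * t"
  by (simp add: gegenbauer_def)

text \<open>The normalising value in the denominator of \<open>qker\<close>. At t = 1 the Pochhammer
  quotients satisfy the same recurrence and initial values.\<close>

lemma gegenbauer_at_1:
  assumes "\<nu> \<noteq> 0"
  shows "gegenbauer \<nu> n 1 = pochhammer (2 * \<nu>) n / fact n"
proof (induction n rule: less_induct)
  case (less n)
  consider "n = 0" | "n = Suc 0" | k where "n = k + 2"
    by (metis One_nat_def add_2_eq_Suc' not0_implies_Suc)
  then show ?case
  proof cases
    case 3
    have 1: "gegenbauer \<nu> (k + 1) 1 = pochhammer (2 * \<nu>) (Suc k) / fact (Suc k)"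
      and 2: "gegenbauer \<nu> k 1 = pochhammer (2 * \<nu>) k / fact k"
      using less[of "k+1"] less[of k] 3 by auto
    have "real (k + 2) * gegenbauer \<nu> (k + 2) 1 = real (k + 2) * (pochhammer (2 * \<nu>) (Suc (Suc k)) / fact (Suc (Suc k)))"
      unfolding gegenbauer_rec[OF assms] 1 2 pochhammer_Suc
      by (simp add: divide_simps) (simp add: algebra_simps)
    moreover have "real (k + 2) \<noteq> 0" by simp
    ultimately show ?thesis using 3 by (simp only: mult_left_cancel add_2_eq_Suc')
  qed (use assms in \<open>auto simp: gegenbauer_1\<close>)
qed

section \<open>The generating function as a product of two conjugate binomial series\<close>

text \<open>These are the Taylor coefficients of (1 - x)^(-\<nu>).\<close>

definition ucoef :: "real \<Rightarrow> nat \<Rightarrow> real" where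
  "ucoef \<nu> k = pochhammer \<nu> k / fact k"

lemma ucoef_nonneg: "\<nu> \<ge> 0 \<Longrightarrow> ucoef \<nu> k \<ge> 0"
  by (cases "\<nu> = 0") (auto simp: ucoef_def pochhammer_0_left intro!: divide_nonneg_pos less_imp_le[OF pochhammer_pos])

lemma ucoef_Suc: "real (Suc k) * ucoef \<nu> (Suc k) = (\<nu> + real k) * ucoef \<nu> k"
  unfolding ucoef_def pochhammer_Suc fact_Suc by simp

context
  includes fps_syntax
begin

text \<open>The formal power series of (1 - z X)^(-\<nu>). Working formally keeps the algebra apart
  from all questions of convergence.\<close>

definition binser :: "real \<Rightarrow> complex \<Rightarrow> complex fps" where
  "binser \<nu> z = Abs_fps (\<lambda>k. of_real (ucoef \<nu> k) * z ^ k)"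

lemma binser_deriv:
  "(1 - fps_const z * fps_X) * fps_deriv (binser \<nu> z) = fps_const (of_real \<nu> * z) * binser \<nu> z"
proof (rule fps_ext)
  fix n
  have u: "of_nat (Suc k) * complex_of_real (ucoef \<nu> (Suc k)) = (of_real \<nu> + of_nat k) * of_real (ucoef \<nu> k)" for k
    using arg_cong[OF ucoef_Suc[of k \<nu>], of complex_of_real] by simp
  show "((1 - fps_const z * fps_X) * fps_deriv (binser \<nu> z)) $ n = (fps_const (of_real \<nu> * z) * binser \<nu> z) $ n"
  proof (cases n)
    case 0
    then show ?thesis using u[of 0] by (simp add: left_diff_distrib mult.assoc binser_def)
  next
    case (Suc k)
    have "((1 - fps_const z * fps_X) * fps_deriv (binser \<nu> z)) $ n
       = of_nat (Suc n) * of_real (ucoef \<nu> (Suc n)) * z ^ Suc n - z * (of_nat n * of_real (ucoef \<nu> n) * z ^ n)"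
      using Suc by (simp add: left_diff_distrib mult.assoc binser_def)
    also have "\<dots> = of_real \<nu> * of_real (ucoef \<nu> n) * z ^ Suc n"
      unfolding u by (simp add: algebra_simps)
    finally show ?thesis by (simp add: binser_def mult_ac)
  qed
qed

text \<open>On the unit circle 1 - 2 (Re z) X + X^2 factors as (1 - z X)(1 - cnj z X). By
  \<open>binser_deriv\<close> the product of the two series therefore solves a first-order
  differential equation, and comparing its coefficients gives precisely the Gegenbauer
  recurrence.\<close>

lemma gegenbauer_eq_binser:
  assumes "\<nu> \<noteq> 0" "norm z = 1"
  shows "of_real (gegenbauer \<nu> n (Re z)) = (binser \<nu> z * binser \<nu> (cnj z)) $ n"
proof -
  define F where "F = binser \<nu> z * binser \<nu> (cnj z)"
  have zz: "z * cnj z = 1" using assms(2) by (simp add: complex_norm_square[symmetric])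
  have zz': "z + cnj z = of_real (2 * Re z)" by (simp add: complex_add_cnj)
  let ?a = "1 - fps_const z * fps_X" and ?b = "1 - fps_const (cnj z) * fps_X"
  have ring1: "(1 - fps_const u * fps_X) * (1 - fps_const v * fps_X)
      = 1 - fps_const (u + v) * fps_X + fps_const (u * v) * fps_X\<^sup>2" for u v :: complex
    unfolding fps_const_add[symmetric] fps_const_mult[symmetric]
    by (simp only: algebra_simps power2_eq_square mult_1_left mult_1_right)
  have ring2: "fps_const (a * u) * (1 - fps_const v * fps_X) + fps_const (a * v) * (1 - fps_const u * fps_X)
      = fps_const (a * (u + v)) - fps_const ((a + a) * (u * v)) * fps_X" for a u v :: complex
    unfolding fps_const_add[symmetric] fps_const_mult[symmetric]
    by (simp only: algebra_simps mult_1_left mult_1_right)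
  have ab: "?a * ?b = 1 - fps_const (of_real (2 * Re z)) * fps_X + fps_X\<^sup>2"
    unfolding ring1 zz zz' by simp
  have c: "fps_const (of_real \<nu> * z) * ?b + fps_const (of_real \<nu> * cnj z) * ?a
      = fps_const (of_real (2 * \<nu> * Re z)) - fps_const (of_real (2 * \<nu>)) * fps_X"
    unfolding ring2 zz zz' by (simp add: mult_ac)
  have ring: "a * b * (P * Q' + P' * Q) = (a * P') * (b * Q) + (b * Q') * (a * P)"
    for a b P Q P' Q' :: "complex fps"
    by (simp add: algebra_simps)
  have ring': "(u * P) * (b * Q) + (v * Q) * (a * P) = (u * b + v * a) * (P * Q)"
    for a b u v P Q :: "complex fps"
    by (simp add: algebra_simps)
  have "?a * ?b * fps_deriv F = (?a * fps_deriv (binser \<nu> z)) * (?b * binser \<nu> (cnj z))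
      + (?b * fps_deriv (binser \<nu> (cnj z))) * (?a * binser \<nu> z)"
    unfolding F_def fps_deriv_mult by (rule ring)
  also have "\<dots> = (fps_const (of_real \<nu> * z) * binser \<nu> z) * (?b * binser \<nu> (cnj z))
      + (fps_const (of_real \<nu> * cnj z) * binser \<nu> (cnj z)) * (?a * binser \<nu> z)"
    unfolding binser_deriv ..
  also have "\<dots> = (fps_const (of_real \<nu> * z) * ?b + fps_const (of_real \<nu> * cnj z) * ?a) * F"
    unfolding F_def by (rule ring')
  also have "\<dots> = (fps_const (of_real (2 * \<nu> * Re z)) - fps_const (of_real (2 * \<nu>)) * fps_X) * F"
    unfolding c ..
  finally have ode: "(1 - fps_const (of_real (2 * Re z)) * fps_X + fps_X\<^sup>2) * fps_deriv F
      = (fps_const (of_real (2 * \<nu> * Re z)) - fps_const (of_real (2 * \<nu>)) * fps_X) * F"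
    unfolding ab .
  have rec: "of_nat (n + 2) * F $ (n + 2) = of_real (2 * Re z * (real (n + 1) + \<nu>)) * F $ (n + 1)
        - of_real (real n + 2 * \<nu>) * F $ n" for n
  proof -
    have "of_nat (n + 2) * F $ (n + 2) - of_real (2 * Re z) * (of_nat (n + 1) * F $ (n + 1)) + of_nat n * F $ n
        = of_real (2 * \<nu> * Re z) * F $ (n + 1) - of_real (2 * \<nu>) * F $ n"
    proof -
      \<comment> \<open>At \<open>n = 0\<close> the summand with \<open>fps_X\<close> squared
        contributes nothing. For the derivative series this exception disappears, because its
        coefficient at \<open>n - 1\<close> is \<open>n\<close> times a coefficient of
        \<open>F\<close>.\<close>
      have "((1 - fps_const a * fps_X + fps_X\<^sup>2) * D) $ (n + 1)
          = D $ (n + 1) - a * D $ n + (if n = 0 then 0 else D $ (n - 1))" for a :: complex and D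
        unfolding distrib_right left_diff_distrib mult.assoc
        by (simp add: fps_X_power_mult_nth)
      moreover have "((fps_const b - fps_const c * fps_X) * D) $ (n + 1) = b * D $ (n + 1) - c * D $ n"
        for b c :: complex and D
        unfolding left_diff_distrib mult.assoc by simp
      ultimately have "fps_deriv F $ (n + 1) - of_real (2 * Re z) * fps_deriv F $ n
          + (if n = 0 then 0 else fps_deriv F $ (n - 1))
          = of_real (2 * \<nu> * Re z) * F $ (n + 1) - of_real (2 * \<nu>) * F $ n"
        using arg_cong[OF ode, of "\<lambda>f. f $ (n + 1)"] by metis
      moreover have "fps_deriv F $ (n + 1) = of_nat (n + 2) * F $ (n + 2)"
        "fps_deriv F $ n = of_nat (n + 1) * F $ (n + 1)"
        "(if n = 0 then 0 else fps_deriv F $ (n - 1)) = of_nat n * F $ n"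
        by simp_all
      ultimately show ?thesis by (simp only:)
    qed
    moreover have "A = (c * m + p) * y - (k + q) * x" if "A - c * (m * y) + k * x = p * y - q * x"
      for A c m y k x p q :: complex
      using that by (simp add: algebra_simps)
    moreover have "complex_of_real (2 * Re z) * of_nat (n + 1) + of_real (2 * \<nu> * Re z)
        = of_real (2 * Re z * (real (n + 1) + \<nu>))"
      by (simp add: algebra_simps)
    moreover have "of_nat n + complex_of_real (2 * \<nu>) = of_real (real n + 2 * \<nu>)"
      by simp
    ultimately show ?thesis by metis
  qed
  have "of_real (gegenbauer \<nu> n (Re z)) = F $ n"
  proof (induction n rule: less_induct)
    case (less n)
    consider "n = 0" | "n = Suc 0" | k where "n = k + 2"
      by (metis One_nat_def add_2_eq_Suc' not0_implies_Suc)
    then show ?case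
    proof cases
      case 1
      then show ?thesis by (simp add: F_def binser_def ucoef_def)
    next
      case 2
      have "F $ Suc 0 = of_real \<nu> * (z + cnj z)"
        by (simp add: F_def binser_def ucoef_def fps_mult_nth_1 algebra_simps)
      then show ?thesis using 2 by (simp only: zz' gegenbauer_1[OF assms(1)]) simp
    next
      case 3
      have 1: "complex_of_real (gegenbauer \<nu> (k + 1) (Re z)) = F $ (k + 1)"
        and 2: "complex_of_real (gegenbauer \<nu> k (Re z)) = F $ k"
        using less 3 by auto
      have "of_nat (k + 2) * complex_of_real (gegenbauer \<nu> (k + 2) (Re z)) = of_nat (k + 2) * F $ (k + 2)"
        unfolding rec 1[symmetric] 2[symmetric]
        using arg_cong[OF gegenbauer_rec[OF assms(1), of k "Re z"], of complex_of_real]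
        by (simp only: of_real_mult of_real_diff of_real_of_nat_eq)
      moreover have "complex_of_nat (k + 2) \<noteq> 0" unfolding of_nat_eq_0_iff by simp
      ultimately show ?thesis using 3 mult_left_cancel by blast
    qed
  qed
  then show ?thesis by (simp add: F_def)
qed

lemma ex_unit_complex_Re: "\<bar>t\<bar> \<le> 1 \<Longrightarrow> \<exists>z. norm z = 1 \<and> Re z = t"
  by (rule exI[of _ "cis (arccos t)"]) simp

text \<open>In the convolution each term is a nonnegative number times a complex number of modulus
  one. The triangle inequality thus bounds it by the same convolution at z = 1.\<close>

lemma abs_gegenbauer_le:
  assumes "\<nu> > 0" "\<bar>t\<bar> \<le> 1"
  shows "\<bar>gegenbauer \<nu> n t\<bar> \<le> gegenbauer \<nu> n 1"
proof -
  obtain z where z: "norm z = 1" "Re z = t" using ex_unit_complex_Re assms(2) by blast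
  have "\<bar>gegenbauer \<nu> n t\<bar> = norm ((binser \<nu> z * binser \<nu> (cnj z)) $ n)"
    using gegenbauer_eq_binser[of \<nu> z n] assms z by (metis less_irrefl norm_of_real)
  also have "\<dots> \<le> (\<Sum>i=0..n. ucoef \<nu> i * ucoef \<nu> (n - i))"
    unfolding fps_mult_nth
    by (rule sum_norm_le) (use z assms in \<open>simp add: binser_def norm_mult norm_power ucoef_nonneg\<close>)
  also have "\<dots> = Re (of_real (gegenbauer \<nu> n (Re 1)))"
    unfolding gegenbauer_eq_binser[of \<nu> 1, OF less_imp_neq[OF assms(1), symmetric] norm_one]
    by (simp add: fps_mult_nth binser_def)
  finally show ?thesis by simp
qed

lemma binser_sums:
  fixes z :: complex
  assumes "norm z < 1"
  shows "(\<lambda>n. of_real (ucoef \<nu> n) * z ^ n) sums ((1 - z) powr (- of_real \<nu>))"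
proof -
  have "(\<lambda>n. (- complex_of_real \<nu> gchoose n) * (- z) ^ n) sums (1 + - z) powr (- of_real \<nu>)"
    using assms by (intro gen_binomial_complex) simp
  moreover have "(- complex_of_real \<nu> gchoose n) * (- z) ^ n = of_real (ucoef \<nu> n) * z ^ n" for n
  proof -
    have "(- complex_of_real \<nu> gchoose n) = (-1) ^ n * of_real (ucoef \<nu> n)"
      by (simp add: gbinomial_pochhammer ucoef_def pochhammer_of_real)
    moreover have "(- z) ^ n = (-1) ^ n * z ^ n" by (rule power_minus)
    ultimately show ?thesis by simp
  qed
  ultimately show ?thesis by simp
qed

text \<open>The Cauchy product of the binomial series at r z and its conjugate, where t = Re z; the
  square of |1 - r z| is 1 - 2 r t + r^2.\<close>

lemma gegenbauer_sums:
  assumes "\<nu> > 0" "\<bar>t\<bar> \<le> 1" "0 \<le> r" "r < 1"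
  shows "(\<lambda>n. gegenbauer \<nu> n t * r ^ n) sums ((1 - 2 * r * t + r\<^sup>2) powr (- \<nu>))"
    and "summable (\<lambda>n. \<bar>gegenbauer \<nu> n t\<bar> * r ^ n)"
proof -
  \<comment> \<open>Proved for every t, because absolute convergence will follow by comparison with
    t = 1.\<close>
  have main: "(\<lambda>n. gegenbauer \<nu> n t * r ^ n) sums ((1 - 2 * r * t + r\<^sup>2) powr (- \<nu>))" if t: "\<bar>t\<bar> \<le> 1" for t
  proof -
    obtain z where z: "norm z = 1" "Re z = t" using ex_unit_complex_Re t by blast
    let ?a = "\<lambda>(z::complex) n. complex_of_real (ucoef \<nu> n) * (of_real r * z) ^ n"
    have s: "?a z sums ((1 - of_real r * z) powr (- of_real \<nu>))" if "norm z = 1" for z :: complex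
      using that assms by (intro binser_sums) (simp add: norm_mult)
    have ab: "summable (\<lambda>n. norm (?a z n))" if "norm z = 1" for z :: complex
    proof -
      \<comment> \<open>The moduli do not depend on z: they are the terms at z = 1, which are real
        and nonnegative.\<close>
      have "summable (\<lambda>n. Re (?a 1 n))"
        using s[of 1] by (intro summable_Re) (auto dest: sums_summable)
      moreover have "Re (?a 1 n) = norm (?a z n)" for n
        using that assms by (simp add: norm_mult norm_power ucoef_nonneg flip: of_real_power)
      ultimately show ?thesis by simp
    qed
    define w where "w = 1 - of_real r * z"
    have Rew: "Re w > 0"
    proof -
      have "\<bar>Re (of_real r * z)\<bar> \<le> norm (of_real r * z)" by (rule abs_Re_le_cmod)
      also have "\<dots> < 1" using assms z by (simp add: norm_mult)
      finally show ?thesis by (simp add: w_def)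
    qed
    have cw: "1 - of_real r * cnj z = cnj w" by (simp add: w_def)
    have "(\<lambda>k. \<Sum>i\<le>k. ?a z i * ?a (cnj z) (k - i)) sums ((\<Sum>k. ?a z k) * (\<Sum>k. ?a (cnj z) k))"
      using ab[of z] ab[of "cnj z"] z by (intro Cauchy_product_sums) auto
    also have "(\<Sum>k. ?a z k) * (\<Sum>k. ?a (cnj z) k) = w powr (- of_real \<nu>) * cnj w powr (- of_real \<nu>)"
      using s[of z, THEN sums_unique] s[of "cnj z", THEN sums_unique] z unfolding cw w_def[symmetric] by auto
    \<comment> \<open>Conjugation commutes with the complex power because w has positive real part
      and so avoids the branch cut.\<close>
    also have "\<dots> = w powr (- of_real \<nu>) * cnj (w powr (- of_real \<nu>))"
      using Rew by (subst cnj_powr) (auto simp: complex_nonpos_Reals_iff)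
    also have "\<dots> = of_real ((norm (w powr (- of_real \<nu>)))\<^sup>2)"
      by (simp only: complex_norm_square)
    also have "norm (w powr (- of_real \<nu>)) = norm w powr (- \<nu>)"
      using norm_powr_real_powr'[of "- of_real \<nu>" w] by (simp only: Reals_minus_iff Reals_of_real minus_complex.simps Re_complex_of_real uminus_complex.simps)
    also have "(norm w powr (- \<nu>))\<^sup>2 = (norm w ^ 2) powr (- \<nu>)"
      by (simp add: power2_eq_square powr_mult)
    also have "norm w ^ 2 = 1 - 2 * r * t + r\<^sup>2"
    proof -
      have "t\<^sup>2 + (Im z)\<^sup>2 = 1" using z by (auto simp: cmod_def)
      then have "r\<^sup>2 * t\<^sup>2 + r\<^sup>2 * (Im z)\<^sup>2 = r\<^sup>2" unfolding distrib_left[symmetric] by simp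
      then show ?thesis
        unfolding cmod_power2 w_def by (simp add: z power2_eq_square algebra_simps)
    qed
    finally have S: "(\<lambda>k. \<Sum>i\<le>k. ?a z i * ?a (cnj z) (k - i)) sums of_real ((1 - 2 * r * t + r\<^sup>2) powr (- \<nu>))" .
    have "(\<Sum>i\<le>k. ?a z i * ?a (cnj z) (k - i)) = of_real (gegenbauer \<nu> k t * r ^ k)" for k
    proof -
      have "of_real (gegenbauer \<nu> k t * r ^ k) = (binser \<nu> z * binser \<nu> (cnj z)) $ k * of_real r ^ k"
        using gegenbauer_eq_binser[of \<nu> z k] assms z by simp
      also have "\<dots> = (\<Sum>i\<le>k. ?a z i * ?a (cnj z) (k - i))"
        unfolding fps_mult_nth sum_distrib_right atMost_atLeast0
      proof (intro sum.cong refl)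
        fix i assume "i \<in> {0..k}"
        then have "complex_of_real r ^ k = of_real r ^ i * of_real r ^ (k - i)"
          by (simp flip: power_add)
        then show "binser \<nu> z $ i * binser \<nu> (cnj z) $ (k - i) * of_real r ^ k = ?a z i * ?a (cnj z) (k - i)"
          by (simp add: binser_def power_mult_distrib)
      qed
      finally show ?thesis by simp
    qed
    with S show ?thesis by (simp only: sums_of_real_iff)
  qed
  show "(\<lambda>n. gegenbauer \<nu> n t * r ^ n) sums ((1 - 2 * r * t + r\<^sup>2) powr (- \<nu>))"
    by (rule main[OF assms(2)])
  have "summable (\<lambda>n. gegenbauer \<nu> n 1 * r ^ n)" using main[of 1] by (auto dest: sums_summable)
  then show "summable (\<lambda>n. \<bar>gegenbauer \<nu> n t\<bar> * r ^ n)"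
    by (rule summable_comparison_test')
       (use assms abs_gegenbauer_le[OF assms(1,2)] in \<open>auto simp: abs_mult intro!: mult_right_mono\<close>)
qed

end

section \<open>Zonal polynomials and their differential equation\<close>

text \<open>The difference below equals \<open>(n + \<nu>) / \<nu>\<close> times the Gegenbauer polynomial of
  parameter \<open>\<nu>\<close>, but it also makes sense for \<open>\<nu> = 0\<close>, where it is \<open>2 cos (n arccos t)\<close>.\<close>

definition zonal :: "real \<Rightarrow> nat \<Rightarrow> real \<Rightarrow> real" where
  "zonal \<nu> n t = gegenbauer (\<nu> + 1) n t - (if n \<ge> 2 then gegenbauer (\<nu> + 1) (n - 2) t else 0)"

text \<open>Formally (n + \<nu>) / \<nu> times the Gegenbauer coefficient of parameter \<nu>.
  Pulling the first factor \<nu> out of the Pochhammer symbol cancels the denominator, which makes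
  the formula meaningful at \<nu> = 0.\<close>

definition zcoef :: "real \<Rightarrow> nat \<Rightarrow> nat \<Rightarrow> real" where
  "zcoef \<nu> n l = (if 2 * l \<le> n then (-1) ^ l * (real n + \<nu>) * pochhammer (\<nu> + 1) (n - l - 1)
      / (fact l * fact (n - 2 * l)) else 0)"

text \<open>Degree 0 is separate because \<open>n - l - 1\<close> is truncated there and
  \<open>zcoef \<nu> 0 0\<close> is \<nu> instead of 1.\<close>

definition zonal_poly :: "real \<Rightarrow> nat \<Rightarrow> real poly" where
  "zonal_poly \<nu> n = (if n = 0 then 1
     else \<Sum>l\<le>n. monom (zcoef \<nu> n l * 2 ^ (n - 2 * l)) (n - 2 * l))"

lemma gcoef_zcoef_0:
  assumes "n > 0"
  shows "gcoef (\<nu> + 1) n 0 = zcoef \<nu> n 0"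
proof -
  obtain k where k: "n = Suc k" using assms gr0_implies_Suc by blast
  show ?thesis by (simp add: gcoef_def zcoef_def k pochhammer_Suc algebra_simps)
qed

lemma gcoef_zcoef_Suc:
  "gcoef (\<nu> + 1) (k + 2) (Suc l) - gcoef (\<nu> + 1) k l = zcoef \<nu> (k + 2) (Suc l)"
proof (cases "2 * l \<le> k")
  case True
  then obtain m where k: "k = 2 * l + m"
    using le_Suc_ex by blast
  have e: "k - l = l + m" "k + 2 - Suc l = Suc (l + m)" "k + 2 - Suc l - 1 = l + m"
    "k - 2 * l = m" "k + 2 - 2 * Suc l = m" using k by auto
  define Q where "Q = (-1) ^ l * pochhammer (\<nu> + 1) (l + m) / (fact l * fact m)"
  have 0: "gcoef (\<nu> + 1) k l = Q"
    using True unfolding gcoef_def e Q_def by simp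
  have 1: "gcoef (\<nu> + 1) (k + 2) (Suc l) = - Q * (\<nu> + 1 + real (l + m)) / real (Suc l)"
    using True unfolding gcoef_def e Q_def pochhammer_Suc by (simp add: mult_ac del: of_nat_Suc)
  have 2: "zcoef \<nu> (k + 2) (Suc l) = - Q * (real (k + 2) + \<nu>) / real (Suc l)"
    using True unfolding zcoef_def e Q_def by (simp add: mult_ac del: of_nat_Suc of_nat_add)
  show ?thesis
    unfolding 0 1 2 unfolding k by (simp add: divide_simps) (simp add: algebra_simps)
qed (simp add: gcoef_def zcoef_def)

lemma poly_zonal_poly_pos:
  assumes "n > 0"
  shows "poly (zonal_poly \<nu> n) t = (\<Sum>l\<le>n. zcoef \<nu> n l * (2 * t) ^ (n - 2 * l))"
  using assms by (simp add: zonal_poly_def poly_sum poly_monom power_mult_distrib mult.assoc)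

text \<open>This makes \<open>pderiv\<close> and continuity available, uniformly for \<nu> = 0 and
  \<nu> > 0.\<close>

lemma zonal_eq_poly:
  assumes "\<nu> \<ge> 0"
  shows "zonal \<nu> n t = poly (zonal_poly \<nu> n) t"
proof -
  have nz: "\<nu> + 1 \<noteq> 0" using assms by simp
  consider "n = 0" | "n = Suc 0" | k where "n = k + 2"
    by (metis One_nat_def add_2_eq_Suc' not0_implies_Suc)
  then show ?thesis
  proof cases
    case 1
    then show ?thesis by (simp add: zonal_def zonal_poly_def)
  next
    case 2
    then show ?thesis using nz
      by (simp add: zonal_def gegenbauer_1 poly_zonal_poly_pos) (simp add: zcoef_def algebra_simps)
  next
    case 3
    have "gegenbauer (\<nu> + 1) (k + 2) t = gcoef (\<nu> + 1) (k + 2) 0 * (2 * t) ^ (k + 2)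
       + (\<Sum>l\<le>k + 1. gcoef (\<nu> + 1) (k + 2) (Suc l) * (2 * t) ^ (k - 2 * l))"
      using gegenbauer_eq_sum[OF nz, of "k + 2" "Suc (k + 1)" t]
      unfolding sum.atMost_Suc_shift[of _ "k + 1"] by simp
    moreover have "gegenbauer (\<nu> + 1) k t = (\<Sum>l\<le>k + 1. gcoef (\<nu> + 1) k l * (2 * t) ^ (k - 2 * l))"
      by (rule gegenbauer_eq_sum[OF nz]) simp
    moreover have "poly (zonal_poly \<nu> n) t = zcoef \<nu> (k + 2) 0 * (2 * t) ^ (k + 2)
       + (\<Sum>l\<le>k + 1. zcoef \<nu> (k + 2) (Suc l) * (2 * t) ^ (k - 2 * l))"
      using poly_zonal_poly_pos[of "Suc (k + 1)" \<nu> t] 3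
      unfolding sum.atMost_Suc_shift[of _ "k + 1"] by simp
    moreover have "(\<Sum>l\<le>k + 1. zcoef \<nu> (k + 2) (Suc l) * (2 * t) ^ (k - 2 * l))
       = (\<Sum>l\<le>k + 1. gcoef (\<nu> + 1) (k + 2) (Suc l) * (2 * t) ^ (k - 2 * l))
         - (\<Sum>l\<le>k + 1. gcoef (\<nu> + 1) k l * (2 * t) ^ (k - 2 * l))"
      unfolding gcoef_zcoef_Suc[symmetric] left_diff_distrib sum_subtractf ..
    moreover have "zonal \<nu> n t = gegenbauer (\<nu> + 1) (k + 2) t - gegenbauer (\<nu> + 1) k t"
      using 3 by (simp add: zonal_def)
    ultimately show ?thesis
      using gcoef_zcoef_0[of "k + 2" \<nu>] by simp
  qed
qed

text \<open>The two-term recursion that the differential equation imposes on the coefficients. For m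
  = 0 and m = 1 the next coefficient is out of range and the right-hand side vanishes as
  well.\<close>

lemma zcoef_step:
  assumes "2 * l \<le> n" "m = n - 2 * l" "n > 0"
  shows "zcoef \<nu> n (Suc l) * real (Suc l) * (real n - real (Suc l) + \<nu>)
           = - zcoef \<nu> n l * real m * (real m - 1)"
proof (cases "m \<ge> 2")
  case False
  then have "m = 0 \<or> m = 1" by auto
  then show ?thesis using assms False by (auto simp: zcoef_def)
next
  case True
  then obtain j where j: "m = Suc (Suc j)" by (metis add_2_eq_Suc le_Suc_ex)
  have n: "n = 2 * l + j + 2" using assms j by auto
  have e: "n - l - 1 = Suc (l + j)" "n - Suc l - 1 = l + j" "n - 2 * Suc l = j"
    using n by auto
  define Q where "Q = (-1) ^ l * (real n + \<nu>) * pochhammer (\<nu> + 1) (l + j) / (fact l * fact j)"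
  have 1: "zcoef \<nu> n (Suc l) * real (Suc l) = - Q"
    using n unfolding zcoef_def e Q_def by (simp add: mult_ac del: of_nat_Suc of_nat_add)
  have f: "(fact m :: real) = real m * (real m - 1) * fact j" by (simp add: j)
  have m: "real m * (real m - 1) \<noteq> 0" using j by simp
  have "zcoef \<nu> n l = (-1) ^ l * (real n + \<nu>) * (pochhammer (\<nu> + 1) (l + j) * (\<nu> + 1 + real (l + j)))
        / (fact l * (real m * (real m - 1) * fact j))"
    using assms(1) unfolding zcoef_def e assms(2)[symmetric] f pochhammer_Suc by simp
  also have "\<dots> = Q * (\<nu> + 1 + real (l + j)) / (real m * (real m - 1))"
    unfolding Q_def by (simp add: mult_ac)
  finally have 2: "zcoef \<nu> n l * (real m * (real m - 1)) = Q * (\<nu> + 1 + real (l + j))"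
    using m by simp
  have "zcoef \<nu> n (Suc l) * real (Suc l) * (real n - real (Suc l) + \<nu>) = - (Q * (\<nu> + 1 + real (l + j)))"
    unfolding 1 by (simp add: n algebra_simps)
  then show ?thesis unfolding 2[symmetric] by simp
qed

text \<open>In the l-th monomial all terms except the bare second derivative keep the exponent,
  while that one lowers it by two. By \<open>zcoef_step\<close> it cancels what the next monomial
  contributes, so the sum telescopes.\<close>

lemma zonal_poly_ode:
  "(1 - t\<^sup>2) * poly (pderiv (pderiv (zonal_poly \<nu> n))) t
     - (2 * \<nu> + 1) * t * poly (pderiv (zonal_poly \<nu> n)) t
     + real n * (real n + 2 * \<nu>) * poly (zonal_poly \<nu> n) t = 0"
proof (cases "n = 0")
  case True
  then show ?thesis by (simp add: zonal_poly_def)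
next
  case False
  \<comment> \<open>The part of the l-th contribution that keeps its exponent: with m = n - 2l, the
    factor n (n + 2\<nu>) - (2\<nu> + 1) m - m (m - 1) equals 4 l (n - l + \<nu>). It vanishes at l
    = 0, and the coefficient is zero at l = n + 1, so both ends of the telescope are zero.\<close>
  define h where "h l = zcoef \<nu> n l * 2 ^ (n - 2 * l) * t ^ (n - 2 * l)
      * (4 * real l * (real n - real l + \<nu>))" for l
  define c where "c l = zcoef \<nu> n l * 2 ^ (n - 2 * l)" for l
  define m where "m l = n - 2 * l" for l
  have 1: "poly (zonal_poly \<nu> n) t = (\<Sum>l\<le>n. c l * t ^ m l)"
    using False by (simp add: zonal_poly_def poly_sum poly_monom c_def m_def)
  have 2: "poly (pderiv (zonal_poly \<nu> n)) t = (\<Sum>l\<le>n. real (m l) * c l * t ^ (m l - 1))"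
    using False by (simp add: zonal_poly_def higher_pderiv_sum[of 1, simplified] pderiv_monom poly_sum poly_monom c_def m_def)
  have 3: "poly (pderiv (pderiv (zonal_poly \<nu> n))) t
     = (\<Sum>l\<le>n. real (m l - 1) * (real (m l) * c l) * t ^ (m l - 2))"
    using False by (simp add: zonal_poly_def higher_pderiv_sum[of 1, simplified] pderiv_monom poly_sum poly_monom c_def m_def
        numeral_2_eq_2)
  have "(1 - t\<^sup>2) * (real (m l - 1) * (real (m l) * c l) * t ^ (m l - 2))
      - (2 * \<nu> + 1) * t * (real (m l) * c l * t ^ (m l - 1))
      + real n * (real n + 2 * \<nu>) * (c l * t ^ m l) = h l - h (Suc l)" for l
  proof (cases "2 * l \<le> n")
    case False
    then show ?thesis by (simp add: c_def h_def zcoef_def)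
  next
    case True
    have rn: "real n = real (m l) + 2 * real l" using True by (simp add: m_def)
    have a: "t * (real (m l) * c l * t ^ (m l - 1)) = real (m l) * c l * t ^ m l"
      by (cases "m l") auto
    have b: "t\<^sup>2 * (real (m l - 1) * (real (m l) * c l) * t ^ (m l - 2))
        = real (m l) * (real (m l) - 1) * c l * t ^ m l"
    proof (cases "m l \<ge> 2")
      case True
      then obtain j where "m l = j + 2" by (metis add.commute le_Suc_ex)
      then show ?thesis by (simp add: power2_eq_square mult_ac)
    next
      case False
      then have "m l = 0 \<or> m l = 1" by auto
      then show ?thesis by auto
    qed
    have d: "h (Suc l) = - (real (m l - 1) * (real (m l) * c l) * t ^ (m l - 2))"
    proof (cases "m l \<ge> 2")
      case m2: True
      have e: "n - 2 * Suc l = m l - 2" by (simp add: m_def)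
      have p: "(2::real) ^ m l = 2 ^ (m l - 2) * 4"
        using power_add[of "2::real" "m l - 2" 2] m2
        by (simp only: le_add_diff_inverse2) simp
      have "h (Suc l) = (zcoef \<nu> n (Suc l) * real (Suc l) * (real n - real (Suc l) + \<nu>))
          * (2 ^ (m l - 2) * 4) * t ^ (m l - 2)"
        unfolding h_def e by (simp only: mult_ac)
      also have "\<dots> = - zcoef \<nu> n l * real (m l) * (real (m l) - 1) * 2 ^ m l * t ^ (m l - 2)"
        using zcoef_step[OF True m_def[of l], of \<nu>] \<open>n \<noteq> 0\<close> unfolding p by simp
      finally show ?thesis
        using m2 unfolding c_def m_def[symmetric] by (simp add: of_nat_diff mult_ac)
    next
      case False
      then have "m l = 0 \<or> m l = 1" by auto
      moreover have "\<not> 2 * Suc l \<le> n" using False by (simp add: m_def)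
      ultimately show ?thesis by (auto simp: h_def zcoef_def)
    qed
    have "h l = c l * t ^ m l * (4 * real l * (real n - real l + \<nu>))"
      by (simp add: h_def c_def m_def)
    moreover have "real n * (real n + 2 * \<nu>) - (2 * \<nu> + 1) * real (m l) - real (m l) * (real (m l) - 1)
        = 4 * real l * (real n - real l + \<nu>)"
      unfolding rn by (simp add: algebra_simps)
    ultimately have "h l = c l * t ^ m l * (real n * (real n + 2 * \<nu>) - (2 * \<nu> + 1) * real (m l) - real (m l) * (real (m l) - 1))"
      by (simp only:)
    also have "\<dots> = real n * (real n + 2 * \<nu>) * (c l * t ^ m l)
      - (2 * \<nu> + 1) * (real (m l) * c l * t ^ m l) - real (m l) * (real (m l) - 1) * c l * t ^ m l"
      by (simp only: right_diff_distrib left_diff_distrib mult_ac)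
    finally show ?thesis
      unfolding left_diff_distrib b mult.assoc[of _ t] a d by simp
  qed
  then have "(1 - t\<^sup>2) * poly (pderiv (pderiv (zonal_poly \<nu> n))) t
     - (2 * \<nu> + 1) * t * poly (pderiv (zonal_poly \<nu> n)) t
     + real n * (real n + 2 * \<nu>) * poly (zonal_poly \<nu> n) t = (\<Sum>l\<le>n. h l - h (Suc l))"
    unfolding 1 2 3 sum_distrib_left sum_subtractf[symmetric] sum.distrib[symmetric]
    by (intro sum.cong refl)
  also have "\<dots> = h 0 - h (Suc n)" by (rule sum_telescope)
  also have "\<dots> = 0" by (simp add: h_def zcoef_def)
  finally show ?thesis .
qed

text \<open>Only the exponents \<open>n - 2 * l\<close> occur, and all have the parity of
  \<open>n\<close>.\<close>

lemma gegenbauer_minus: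
  assumes "\<nu> \<noteq> 0"
  shows "gegenbauer \<nu> n (- t) = (-1) ^ n * gegenbauer \<nu> n t"
  unfolding gegenbauer_eq_sum[OF assms order_refl] sum_distrib_left
proof (intro sum.cong refl)
  fix l
  show "gcoef \<nu> n l * (2 * - t) ^ (n - 2 * l) = (-1) ^ n * (gcoef \<nu> n l * (2 * t) ^ (n - 2 * l))"
  proof (cases "2 * l \<le> n")
    case True
    then have "(-1 :: real) ^ n = (-1) ^ (n - 2 * l)"
      using power_add[of "-1::real" "n - 2 * l" "2 * l"] by simp
    then show ?thesis using power_minus[of "2 * t" "n - 2 * l"] by simp
  qed (simp add: gcoef_def)
qed

lemma zonal_minus: "\<nu> \<ge> 0 \<Longrightarrow> zonal \<nu> n (- t) = (-1) ^ n * zonal \<nu> n t"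
  by (auto simp: zonal_def gegenbauer_minus algebra_simps simp flip: power_add dest!: le_Suc_ex)

lemma zonal_0 [simp]: "zonal \<nu> 0 t = 1"
  by (simp add: zonal_def)

text \<open>The triangle inequality for the difference on [-1, 1]. Its power series still converges
  for r < 1, which is all that the termwise integrations require.\<close>

definition zonal_bound :: "real \<Rightarrow> nat \<Rightarrow> real" where
  "zonal_bound \<nu> n = gegenbauer (\<nu> + 1) n 1 + (if n \<ge> 2 then gegenbauer (\<nu> + 1) (n - 2) 1 else 0)"

lemma abs_zonal_le:
  assumes "\<nu> \<ge> 0" "\<bar>t\<bar> \<le> 1"
  shows "\<bar>zonal \<nu> n t\<bar> \<le> zonal_bound \<nu> n"
proof -
  have "\<bar>gegenbauer (\<nu> + 1) k t\<bar> \<le> gegenbauer (\<nu> + 1) k 1" for k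
    using assms by (intro abs_gegenbauer_le) auto
  from this[of n] this[of "n - 2"] show ?thesis
    by (auto simp: zonal_def zonal_bound_def)
qed

lemma sums_shift_two:
  fixes f :: "nat \<Rightarrow> real"
  assumes "(\<lambda>n. f n * r ^ n) sums s"
  shows "(\<lambda>n. (if n \<ge> 2 then f (n - 2) else 0) * r ^ n) sums (r\<^sup>2 * s)"
proof -
  have "(\<lambda>n. r\<^sup>2 * (f n * r ^ n)) sums (r\<^sup>2 * s)" by (rule sums_mult[OF assms])
  then have "(\<lambda>n. (if n + 2 \<ge> 2 then f (n + 2 - 2) else 0) * r ^ (n + 2)) sums (r\<^sup>2 * s)"
    by (simp add: power_add mult_ac power2_eq_square)
  then show ?thesis
    by (subst (asm) sums_iff_shift) (simp add: numeral_2_eq_2)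
qed

lemma zonal_sums:
  assumes "\<nu> \<ge> 0" "\<bar>t\<bar> \<le> 1" "0 \<le> r" "r < 1"
  shows "(\<lambda>n. zonal \<nu> n t * r ^ n) sums ((1 - r\<^sup>2) * (1 - 2 * r * t + r\<^sup>2) powr (- (\<nu> + 1)))"
proof -
  have 1: "(\<lambda>n. gegenbauer (\<nu> + 1) n t * r ^ n) sums ((1 - 2 * r * t + r\<^sup>2) powr (- (\<nu> + 1)))"
    using assms by (intro gegenbauer_sums) auto
  show ?thesis
    using sums_diff[OF 1 sums_shift_two[OF 1]] by (simp add: zonal_def algebra_simps)
qed

lemma summable_zonal_bound:
  assumes "\<nu> \<ge> 0" "0 \<le> r" "r < 1"
  shows "summable (\<lambda>n. zonal_bound \<nu> n * r ^ n)"
proof -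
  have 1: "(\<lambda>n. gegenbauer (\<nu> + 1) n 1 * r ^ n) sums ((1 - 2 * r * 1 + r\<^sup>2) powr (- (\<nu> + 1)))"
    using assms by (intro gegenbauer_sums) auto
  show ?thesis
    using sums_add[OF 1 sums_shift_two[OF 1]]
    by (auto simp: zonal_bound_def distrib_right dest: sums_summable)
qed

text \<open>Parameter 1 gives the Chebyshev polynomials of the second kind, and U_n - U_(n-2) = 2
  T_n.\<close>

lemma zonal_nu_0:
  assumes "n > 0" "\<bar>t\<bar> \<le> 1"
  shows "zonal 0 n t = 2 * cos (real n * arccos t)"
proof -
  define \<theta> where "\<theta> = arccos t"
  have t: "t = cos \<theta>" using assms by (simp add: \<theta>_def)
  have rec: "gegenbauer 1 (n + 2) t = 2 * t * gegenbauer 1 (n + 1) t - gegenbauer 1 n t" for n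
  proof -
    have "real (n + 2) * gegenbauer 1 (n + 2) t = real (n + 2) * (2 * t * gegenbauer 1 (n + 1) t - gegenbauer 1 n t)"
      using gegenbauer_rec[of 1 n t] by (simp add: algebra_simps)
    moreover have "real (n + 2) \<noteq> 0" by simp
    ultimately show ?thesis using mult_left_cancel by blast
  qed
  have U: "gegenbauer 1 (k + 2) t - gegenbauer 1 k t = 2 * cos (real (k + 2) * \<theta>)" for k
  proof (induction k rule: less_induct)
    case (less k)
    consider "k = 0" | "k = Suc 0" | j where "k = j + 2"
      by (metis One_nat_def add_2_eq_Suc' not0_implies_Suc)
    then show ?case
    proof cases
      case 1
      then show ?thesis using rec[of 0] cos_double_cos[of \<theta>]
        by (simp add: gegenbauer_1 t power2_eq_square)
    next
      case 2
      have "gegenbauer 1 2 t = 4 * t\<^sup>2 - 1"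
        using rec[of 0] by (simp add: gegenbauer_1 power2_eq_square numeral_2_eq_2)
      then have "gegenbauer 1 3 t = 2 * t * (4 * t\<^sup>2 - 1) - 2 * t"
        using rec[of 1] by (simp add: gegenbauer_1 numeral_3_eq_3 numeral_2_eq_2)
      then show ?thesis using 2 cos_treble_cos[of \<theta>]
        by (simp add: gegenbauer_1 t numeral_3_eq_3 numeral_2_eq_2 algebra_simps)
    next
      case 3
      have "gegenbauer 1 (j + 4) t - gegenbauer 1 (j + 2) t
          = 2 * t * (gegenbauer 1 (j + 3) t - gegenbauer 1 (j + 1) t) - (gegenbauer 1 (j + 2) t - gegenbauer 1 j t)"
        using rec[of "j + 2"] rec[of j] by (simp add: algebra_simps eval_nat_numeral)
      also have "\<dots> = 2 * t * (2 * cos (real (j + 3) * \<theta>)) - 2 * cos (real (j + 2) * \<theta>)"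
        using less[of j] less[of "j + 1"] 3 by (simp add: eval_nat_numeral)
      also have "\<dots> = 2 * cos (real (j + 4) * \<theta>)"
      proof -
        have "real (j + 4) * \<theta> = real (j + 3) * \<theta> + \<theta>" "real (j + 2) * \<theta> = real (j + 3) * \<theta> - \<theta>"
          by (simp_all add: algebra_simps)
        then show ?thesis unfolding t by (simp only: cos_add cos_diff) simp
      qed
      finally show ?thesis using 3 by (simp add: eval_nat_numeral)
    qed
  qed
  show ?thesis
  proof (cases "n \<ge> 2")
    case True
    then have "n - 2 + 2 = n" by simp
    with U[of "n - 2"] True show ?thesis by (simp only: zonal_def \<theta>_def) simp
  next
    case False
    then have "n = Suc 0" using assms by simp
    then show ?thesis using t by (simp add: zonal_def gegenbauer_1 \<theta>_def)
  qed
qed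

lemma zonal_nu_pos:
  assumes "\<nu> > 0"
  shows "zonal \<nu> n t = (real n + \<nu>) / \<nu> * gegenbauer \<nu> n t"
proof (cases "n = 0")
  case False
  have "zcoef \<nu> n l = (real n + \<nu>) / \<nu> * gcoef \<nu> n l" for l
  proof (cases "2 * l \<le> n")
    case True
    then have "n - l = Suc (n - l - 1)" using False by auto
    then have "pochhammer \<nu> (n - l) = \<nu> * pochhammer (\<nu> + 1) (n - l - 1)"
      using pochhammer_rec[of \<nu> "n - l - 1"] by simp
    then show ?thesis using assms by (simp add: zcoef_def gcoef_def)
  qed (simp add: zcoef_def gcoef_def)
  then show ?thesis
    using False assms by (simp add: zonal_eq_poly poly_zonal_poly_pos gegenbauer_eq_sum[OF _ order_refl]
        sum_distrib_left mult.assoc)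
qed (use assms in simp)

section \<open>The reproducing kernel in terms of zonal polynomials\<close>

lemma pochhammer_Suc_fact: "pochhammer (real (Suc e)) n * fact e = fact (e + n)"
proof (induction n)
  case (Suc n)
  have "pochhammer (real (Suc e)) (Suc n) * fact e = (pochhammer (real (Suc e)) n * fact e) * (real (Suc e) + real n)"
    by (simp add: pochhammer_Suc)
  then show ?case unfolding Suc.IH by (simp add: algebra_simps)
qed simp

text \<open>For d > 2 the dimension is exactly (n + \<nu>) / \<nu> times the Gegenbauer value at 1.
  For d = 2 and n > 0 it is 2 and the quotient is the cosine.\<close>

lemma harm_dim_gegenbauer:
  assumes "d \<ge> 2" "\<bar>t\<bar> \<le> 1"
  shows "harm_dim n d * gegenbauer (gnu d) n t / gegenbauer (gnu d) n 1 = zonal (gnu d) n t"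
proof (cases "n = 0")
  case True
  then show ?thesis by (simp add: harm_dim_def)
next
  case n: False
  show ?thesis
  proof (cases "d = 2")
    case True
    have "harm_dim n 2 = 2" using n by (simp add: harm_dim_def)
    then show ?thesis using True n assms
      by (simp add: gnu_def zonal_nu_0) (simp add: gegenbauer_def)
  next
    case False
    \<comment> \<open>Now 2\<nu> = e + 1, so the Pochhammer symbol at 2\<nu> is a quotient of
      factorials and no truncated subtraction remains.\<close>
    define e where "e = d - 3"
    have d: "d = e + 3" using False assms(1) by (simp add: e_def)
    have nu: "gnu d = real (Suc e) / 2" "gnu d > 0" by (simp_all add: gnu_def d)
    have g1: "gegenbauer (gnu d) n 1 = fact (e + n) / (fact e * fact n)"
      using pochhammer_Suc_fact[of e n] nu(2)
      by (simp add: gegenbauer_at_1 nu(1) field_simps del: of_nat_Suc)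
    have x: "n + d - 2 = Suc (e + n)" "d - 2 = Suc e" "2 * n + d - 2 = 2 * n + Suc e" using d by auto
    have "harm_dim n d = real (2 * n + Suc e) * fact (e + n) / (fact n * (real (Suc e) * fact e))"
      using n unfolding harm_dim_def x by (simp del: of_nat_Suc of_nat_add)
    also have "\<dots> = (real n + gnu d) / gnu d * gegenbauer (gnu d) n 1"
    proof -
      have "(2 * a + s) * A / (N * (s * E)) = (a + s / 2) / (s / 2) * (A / (E * N))"
        if "s > 0" for a s A N E :: real
        using that by (simp add: divide_simps)
      from this[of "real (Suc e)" "real n"] show ?thesis
        unfolding g1 unfolding nu(1) by (simp only: of_nat_add of_nat_mult of_nat_numeral of_nat_0_less_iff zero_less_Suc)
    qed
    finally have "harm_dim n d = (real n + gnu d) / gnu d * gegenbauer (gnu d) n 1" .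
    moreover have "gegenbauer (gnu d) n 1 \<noteq> 0" unfolding g1 by simp
    ultimately show ?thesis using nu(2) by (simp add: zonal_nu_pos)
  qed
qed

lemma qker_eq_zonal:
  fixes x y :: "real^'n"
  assumes "CARD('n) \<ge> 2" "norm x = 1" "norm y = 1"
  shows "qker n CARD('n) x y = zonal (gnu CARD('n)) n (x \<bullet> y) / sphere_area CARD('n)"
proof -
  have "\<bar>x \<bullet> y\<bar> \<le> 1" using Cauchy_Schwarz_ineq2[of x y] assms by simp
  from harm_dim_gegenbauer[OF assms(1) this, of n] show ?thesis
    unfolding qker_def by (metis divide_divide_eq_left mult.commute)
qed

section \<open>Invariance of the surface measure\<close>

lemma nn_integral_lborel_translate:
  fixes f :: "'a::euclidean_space \<Rightarrow> ennreal"
  assumes "f \<in> borel_measurable borel"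
  shows "(\<integral>\<^sup>+x. f (c + x) \<partial>lborel) = (\<integral>\<^sup>+x. f x \<partial>lborel)"
proof -
  have "(\<integral>\<^sup>+x. f x \<partial>lborel) = (\<integral>\<^sup>+x. f x \<partial>distr lborel borel ((+) c))"
    by (simp add: lborel_distr_plus)
  also have "\<dots> = (\<integral>\<^sup>+x. f (c + x) \<partial>lborel)"
    using assms by (subst nn_integral_distr) auto
  finally show ?thesis ..
qed

text \<open>The image of Lebesgue measure under \<open>T\<close> is again translation invariant; comparing the two
  measures with \<open>B\<close> by means of Tonelli's theorem shows that they are equal.\<close>

lemma emeasure_lborel_orthogonal_vimage:
  fixes T :: "'a::euclidean_space \<Rightarrow> 'a"
  assumes T: "orthogonal_transformation T" and A: "A \<in> sets borel"
  shows "emeasure lborel (T -` A) = emeasure lborel A"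
proof -
  have lin: "linear T" using T by (rule orthogonal_transformation_linear)
  have Tm [measurable]: "T \<in> borel_measurable borel"
    using lin by (intro borel_measurable_continuous_onI linear_continuous_on linear_conv_bounded_linear[THEN iffD1])
  note A [measurable]
  define B where "B = ball (0::'a) 1"
  have [measurable]: "B \<in> sets borel" by (simp add: B_def)
  obtain S where S: "\<And>y. T (S y) = y"
    using orthogonal_transformation_surj[OF T] by (metis surjD)
  let ?L = "lborel :: 'a measure"
  have ind: "indicator (T -` A) x = (indicator A (T x) :: ennreal)" for x
    by (auto simp: indicator_def)
  have TA: "T -` A \<in> sets borel" using measurable_sets[OF Tm A] by simp
  have "emeasure ?L (T -` A) * emeasure ?L B
      = (\<integral>\<^sup>+y. (\<integral>\<^sup>+x. indicator A (T x) * indicator B y \<partial>?L) \<partial>?L)"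
    using TA by (simp add: nn_integral_multc nn_integral_cmult flip: ind)
  \<comment> \<open>Shifting x by the preimage of y couples the two variables, so that after Tonelli
    the y-integral can be translated by T x in turn.\<close>
  also have "\<dots> = (\<integral>\<^sup>+y. (\<integral>\<^sup>+x. indicator A (y + T x) * indicator B y \<partial>?L) \<partial>?L)"
  proof (rule nn_integral_cong)
    fix y
    have "(\<integral>\<^sup>+x. indicator A (T x) * indicator B y \<partial>?L) = (\<integral>\<^sup>+x. indicator A (T (S y + x)) * indicator B y \<partial>?L)"
      by (rule nn_integral_lborel_translate[symmetric]) measurable
    then show "(\<integral>\<^sup>+x. indicator A (T x) * indicator B y \<partial>?L) = (\<integral>\<^sup>+x. indicator A (y + T x) * indicator B y \<partial>?L)"
      using lin S by (simp add: linear_add)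
  qed
  also have "\<dots> = (\<integral>\<^sup>+x. (\<integral>\<^sup>+y. indicator A (y + T x) * indicator B y \<partial>?L) \<partial>?L)"
    by (rule lborel_pair.Fubini') measurable
  also have "\<dots> = (\<integral>\<^sup>+x. (\<integral>\<^sup>+y. indicator A y * indicator B (y - T x) \<partial>?L) \<partial>?L)"
  proof (rule nn_integral_cong)
    fix x
    have "(\<integral>\<^sup>+y. indicator A (T x + y) * indicator B (T x + y - T x) \<partial>?L) = (\<integral>\<^sup>+y. indicator A y * indicator B (y - T x) \<partial>?L)"
      by (rule nn_integral_lborel_translate) measurable
    then show "(\<integral>\<^sup>+y. indicator A (y + T x) * indicator B y \<partial>?L) = (\<integral>\<^sup>+y. indicator A y * indicator B (y - T x) \<partial>?L)"
      by (simp add: add.commute)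
  qed
  also have "\<dots> = (\<integral>\<^sup>+y. (\<integral>\<^sup>+x. indicator A y * indicator B (y - T x) \<partial>?L) \<partial>?L)"
    by (rule lborel_pair.Fubini') measurable
  \<comment> \<open>As T is an isometry, the condition on x describes a unit ball around the
    preimage of y, and its volume does not depend on y.\<close>
  also have "\<dots> = (\<integral>\<^sup>+y. indicator A y * emeasure ?L B \<partial>?L)"
  proof (rule nn_integral_cong)
    fix y
    have "indicator B (y - T x) = (indicator (ball (S y) 1) x :: ennreal)" for x
    proof -
      have "norm (y - T x) = norm (S y - x)"
        using orthogonal_transformation_norm[OF T, of "S y - x"] lin S by (simp add: linear_diff)
      then show ?thesis by (simp add: B_def indicator_def dist_norm norm_minus_commute)
    qed
    then have "(\<integral>\<^sup>+x. indicator A y * indicator B (y - T x) \<partial>?L) = indicator A y * emeasure ?L (ball (S y) 1)"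
      by (simp add: nn_integral_cmult_indicator)
    also have "emeasure ?L (ball (S y) 1) = emeasure ?L B"
      by (simp add: B_def emeasure_ball)
    finally show "(\<integral>\<^sup>+x. indicator A y * indicator B (y - T x) \<partial>?L) = indicator A y * emeasure ?L B" .
  qed
  also have "\<dots> = emeasure ?L A * emeasure ?L B"
    using A by (simp add: nn_integral_multc)
  finally have "emeasure ?L (T -` A) * emeasure ?L B = emeasure ?L A * emeasure ?L B" .
  moreover have "unit_ball_vol (real DIM('a)) \<noteq> 0"
    by (rule less_imp_neq[symmetric, OF unit_ball_vol_pos]) simp
  then have "emeasure ?L B \<noteq> 0" "emeasure ?L B \<noteq> \<infinity>"
    by (auto simp: B_def emeasure_ball)
  ultimately show ?thesis
    by (metis ennreal_mult_cancel_left mult.commute infinity_ennreal_def)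
qed

lemma space_sphere_measure [simp]: "space sphere_measure = sphere (0::real^'n) 1"
  by (simp add: sphere_measure_def space_scale_measure space_restrict_space)

lemma sets_sphere_measure [measurable_cong]:
  "sets sphere_measure = sets (restrict_space borel (sphere (0::real^'n) 1))"
  by (simp add: sphere_measure_def)

lemma measurable_radial:
  "(\<lambda>x. x /\<^sub>R norm x) \<in> restrict_space lborel (ball 0 1 - {0})
      \<rightarrow>\<^sub>M restrict_space borel (sphere (0::'a::euclidean_space) 1)"
proof (rule measurable_restrict_space3)
  show "(\<lambda>x::'a. x /\<^sub>R norm x) \<in> lborel \<rightarrow>\<^sub>M borel" by measurable
qed auto

lemma emeasure_sphere_measure:
  fixes A :: "(real^'n) set"
  assumes "A \<in> sets sphere_measure"
  shows "emeasure sphere_measure A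
    = of_nat CARD('n) * emeasure lborel {x \<in> ball 0 1 - {0}. x /\<^sub>R norm x \<in> A}"
proof -
  have "(\<lambda>x. x /\<^sub>R norm x) -` A \<inter> (ball 0 1 - {0}) = {x \<in> ball 0 1 - {0}. x /\<^sub>R norm x \<in> A}"
    by auto
  moreover have "emeasure (restrict_space lborel (ball 0 1 - {0})) {x \<in> ball 0 1 - {0}. x /\<^sub>R norm x \<in> A}
      = emeasure lborel {x \<in> ball 0 1 - {0}. x /\<^sub>R norm x \<in> A}"
    by (intro emeasure_restrict_space) auto
  moreover have "A \<in> sets (restrict_space borel (sphere 0 1))"
    using assms by (simp add: sets_sphere_measure)
  ultimately show ?thesis
    unfolding sphere_measure_def
    by (simp only: emeasure_scale_measure emeasure_distr[OF measurable_radial] space_restrict_space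
        space_lborel space_borel Int_UNIV_right)
qed

text \<open>The cone over the whole sphere is the punctured ball, so the mass is d times the volume
  of the unit ball; Gamma (d/2 + 1) = (d/2) Gamma (d/2) gives the closed form.\<close>

lemma emeasure_sphere_measure_space:
  "emeasure sphere_measure (sphere (0::real^'n) 1) = ennreal (sphere_area CARD('n))"
proof -
  let ?d = "real CARD('n)"
  have "sphere (0::real^'n) 1 \<in> sets sphere_measure"
    using sets.top[of "sphere_measure :: (real^'n) measure"] by simp
  then have "emeasure sphere_measure (sphere (0::real^'n) 1)
      = of_nat CARD('n) * emeasure lborel {x \<in> ball 0 1 - {0}. x /\<^sub>R norm x \<in> sphere (0::real^'n) 1}"
    by (rule emeasure_sphere_measure)
  also have "{x \<in> ball 0 1 - {0}. x /\<^sub>R norm x \<in> sphere (0::real^'n) 1} = ball 0 1 - {0}"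
    by auto
  also have "emeasure lborel (ball 0 1 - {0} :: (real^'n) set) = emeasure lborel (ball (0::real^'n) 1)"
    by (rule emeasure_Diff_null_set) auto
  also have "\<dots> = ennreal (unit_ball_vol ?d)"
    by (simp add: emeasure_ball)
  also have "of_nat CARD('n) * ennreal (unit_ball_vol ?d) = ennreal (?d * unit_ball_vol ?d)"
    by (simp add: ennreal_mult flip: ennreal_of_nat_eq_real_of_nat)
  also have "?d * unit_ball_vol ?d = sphere_area CARD('n)"
  proof -
    have "Gamma (?d / 2 + 1) = ?d / 2 * Gamma (?d / 2)"
    proof (rule Gamma_plus1)
      have "?d / 2 > 0" by simp
      then show "?d / 2 \<notin> \<int>\<^sub>\<le>\<^sub>0" using nonpos_Ints_nonpos by fastforce
    qed
    then show ?thesis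
      using Gamma_real_pos[of "?d / 2"] unfolding unit_ball_vol_def sphere_area_def
      by (simp only:) (simp add: field_simps)
  qed
  finally show ?thesis .
qed

lemma sphere_area_pos: "d > 0 \<Longrightarrow> sphere_area d > 0"
  by (simp add: sphere_area_def Gamma_real_pos)

lemma finite_measure_sphere: "finite_measure (sphere_measure :: (real^'n) measure)"
  by (rule finite_measureI) (simp add: emeasure_sphere_measure_space)

lemma measure_sphere_measure: "measure sphere_measure (sphere (0::real^'n) 1) = sphere_area CARD('n)"
  using sphere_area_pos[of "CARD('n)"] by (simp add: measure_def emeasure_sphere_measure_space)

lemma measurable_sphere_continuous:
  fixes f :: "real^'n \<Rightarrow> 'b::topological_space"
  assumes "continuous_on (sphere 0 1) f"
  shows "f \<in> borel_measurable sphere_measure"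
  using borel_measurable_continuous_on_restrict[OF assms]
  by (simp cong: measurable_cong_sets add: sets_sphere_measure)

lemma measurable_sphere_borel:
  fixes f :: "real^'n \<Rightarrow> 'b"
  assumes "f \<in> borel \<rightarrow>\<^sub>M N"
  shows "f \<in> sphere_measure \<rightarrow>\<^sub>M N"
  unfolding measurable_cong_sets[OF sets_sphere_measure refl]
  using assms by (rule measurable_restrict_space1)

lemma integrable_sphere_bounded:
  fixes f :: "real^'n \<Rightarrow> real"
  assumes "f \<in> borel_measurable sphere_measure" "\<And>x. norm x = 1 \<Longrightarrow> \<bar>f x\<bar> \<le> B"
  shows "integrable sphere_measure f"
proof -
  interpret finite_measure "sphere_measure :: (real^'n) measure" by (rule finite_measure_sphere)
  show ?thesis
    using assms by (intro integrable_const_bound[of _ B]) auto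
qed

lemma integrable_sphere_continuous:
  fixes f :: "real^'n \<Rightarrow> real"
  assumes "continuous_on (sphere 0 1) f"
  shows "integrable sphere_measure f"
proof -
  have "compact (f ` sphere 0 1)" by (rule compact_continuous_image[OF assms]) simp
  then obtain B where "\<And>x. x \<in> sphere 0 1 \<Longrightarrow> norm (f x) \<le> B"
    by (meson bounded_iff compact_imp_bounded imageI)
  then show ?thesis
    by (intro integrable_sphere_bounded[of _ B] measurable_sphere_continuous assms) auto
qed

lemma measurable_sphere_orthogonal:
  fixes T :: "real^'n \<Rightarrow> real^'n"
  assumes "orthogonal_transformation T"
  shows "T \<in> sphere_measure \<rightarrow>\<^sub>M sphere_measure"
proof -
  have "linear T" using assms by (rule orthogonal_transformation_linear)
  then have "T \<in> borel_measurable borel"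
    by (intro borel_measurable_continuous_onI linear_continuous_on linear_conv_bounded_linear[THEN iffD1])
  then show ?thesis
    unfolding measurable_cong_sets[OF sets_sphere_measure sets_sphere_measure]
    by (rule measurable_restrict_space3) (use orthogonal_transformation_norm[OF assms] in auto)
qed

text \<open>An orthogonal map preserves norms and commutes with scaling, so the cone over a preimage
  is the preimage of the cone. Invariance of Lebesgue measure is thereby inherited.\<close>

lemma distr_sphere_orthogonal:
  fixes T :: "real^'n \<Rightarrow> real^'n"
  assumes T: "orthogonal_transformation T"
  shows "distr sphere_measure sphere_measure T = sphere_measure"
proof (rule measure_eqI)
  fix A assume "A \<in> sets (distr sphere_measure sphere_measure T)"
  then have A: "A \<in> sets sphere_measure" by simp
  have m: "T \<in> sphere_measure \<rightarrow>\<^sub>M sphere_measure" by (rule measurable_sphere_orthogonal[OF T])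
  have TA: "T -` A \<inter> sphere 0 1 \<in> sets sphere_measure"
    using measurable_sets[OF m A] by simp
  have lin: "linear T" using T by (rule orthogonal_transformation_linear)
  define C where "C = {x \<in> ball 0 1 - {0}. x /\<^sub>R norm x \<in> A}"
  have C: "C \<in> sets borel"
  proof -
    have "(\<lambda>x. x /\<^sub>R norm x) -` A \<inter> space (restrict_space lborel (ball 0 1 - {0}))
        \<in> sets (restrict_space lborel (ball (0::real^'n) 1 - {0}))"
      using A unfolding sets_sphere_measure by (rule measurable_sets[OF measurable_radial])
    moreover have "(\<lambda>x. x /\<^sub>R norm x) -` A \<inter> space (restrict_space lborel (ball 0 1 - {0})) = C"
      by (auto simp: C_def space_restrict_space)
    ultimately show ?thesis by (simp add: sets_restrict_space_iff)
  qed
  have nT: "norm (T x) = norm x" for x by (rule orthogonal_transformation_norm[OF T])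
  have T0: "T x = 0 \<longleftrightarrow> x = 0" for x using nT by (metis norm_eq_zero)
  have "emeasure (distr sphere_measure sphere_measure T) A = emeasure sphere_measure (T -` A \<inter> sphere 0 1)"
    using m A by (simp add: emeasure_distr)
  also have "\<dots> = of_nat CARD('n) * emeasure lborel {x \<in> ball 0 1 - {0}. x /\<^sub>R norm x \<in> T -` A \<inter> sphere 0 1}"
    by (rule emeasure_sphere_measure[OF TA])
  also have "{x \<in> ball 0 1 - {0}. x /\<^sub>R norm x \<in> T -` A \<inter> sphere 0 1} = T -` C"
    by (auto simp: C_def nT T0 linear_scale[OF lin])
  also have "emeasure lborel (T -` C) = emeasure lborel C"
    by (rule emeasure_lborel_orthogonal_vimage[OF T C])
  finally show "emeasure (distr sphere_measure sphere_measure T) A = emeasure sphere_measure A"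
    unfolding emeasure_sphere_measure[OF A] C_def .
qed simp

lemma integral_sphere_orthogonal:
  fixes T :: "real^'n \<Rightarrow> real^'n" and f :: "real^'n \<Rightarrow> real"
  assumes "orthogonal_transformation T" "f \<in> borel_measurable sphere_measure"
  shows "(\<integral>x. f (T x) \<partial>sphere_measure) = (\<integral>x. f x \<partial>sphere_measure)"
  using integral_distr[OF measurable_sphere_orthogonal[OF assms(1)] assms(2)]
  by (simp add: distr_sphere_orthogonal[OF assms(1)])

lemma orthogonal_transformation_uminus: "orthogonal_transformation (uminus :: 'a::euclidean_space \<Rightarrow> 'a)"
  by (simp add: orthogonal_transformation_def linear_uminus)

lemma AE_sphere_uminus:
  assumes "AE x in (sphere_measure :: (real^'n) measure). P x"
  shows "AE x in (sphere_measure :: (real^'n) measure). P (- x)"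
proof -
  have "AE x in distr sphere_measure sphere_measure (uminus :: real^'n \<Rightarrow> real^'n). P x"
    by (subst distr_sphere_orthogonal[OF orthogonal_transformation_uminus]) (rule assms)
  then show ?thesis
    by (rule AE_distrD[OF measurable_sphere_orthogonal[OF orthogonal_transformation_uminus]])
qed

text \<open>The cone over a great sphere lies in a hyperplane, which is Lebesgue null.\<close>

lemma AE_sphere_inner_nonzero:
  fixes a :: "real^'n"
  assumes "a \<noteq> 0"
  shows "AE x in sphere_measure. a \<bullet> x \<noteq> 0"
proof -
  define N where "N = {x \<in> sphere 0 1. a \<bullet> x = 0}"
  have N: "N \<in> sets sphere_measure"
  proof -
    have "{x. a \<bullet> x = 0} \<in> sets borel" by measurable
    moreover have "N = sphere 0 1 \<inter> {x. a \<bullet> x = 0}" by (auto simp: N_def)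
    ultimately show ?thesis by (auto simp: sets_sphere_measure sets_restrict_space)
  qed
  have h: "{x. a \<bullet> x = 0} \<in> null_sets lborel"
    using negligible_hyperplane[of a 0] assms
    by (simp add: negligible_iff_null_sets null_sets_completion_iff closed_hyperplane borel_closed)
  have "emeasure lborel {x \<in> ball 0 1 - {0}. x /\<^sub>R norm x \<in> N} = 0"
    by (rule null_setsD1, rule null_sets_subset[OF h])
       (use h in \<open>auto simp: N_def\<close>)
  then have "emeasure sphere_measure N = 0"
    by (simp add: emeasure_sphere_measure[OF N])
  then show ?thesis
    using N by (intro AE_I[of _ _ N]) (auto simp: N_def)
qed

section \<open>Orthogonality of zonal kernels\<close>

text \<open>Rotation by \<theta> in the coordinate plane of i and j, for distinct i and j. Written
  as the identity plus a correction, it has explicit inner products with a fixed vector without case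
  distinctions on coordinates.\<close>

definition rot :: "'n::finite \<Rightarrow> 'n \<Rightarrow> real \<Rightarrow> real^'n \<Rightarrow> real^'n" where
  "rot i j \<theta> z = z + ((cos \<theta> - 1) * z $ i - sin \<theta> * z $ j) *\<^sub>R axis i 1
       + (sin \<theta> * z $ i + (cos \<theta> - 1) * z $ j) *\<^sub>R axis j 1"

lemma rot_0 [simp]: "rot i j 0 z = z"
  by (simp add: rot_def)

lemma inner_rot:
  "a \<bullet> rot i j \<theta> z = a \<bullet> z + ((cos \<theta> - 1) * z $ i - sin \<theta> * z $ j) * a $ i
       + (sin \<theta> * z $ i + (cos \<theta> - 1) * z $ j) * a $ j"
  by (simp add: rot_def inner_add_right inner_axis)

lemma rot_nth:
  assumes "i \<noteq> j"
  shows "rot i j \<theta> z $ i = cos \<theta> * z $ i - sin \<theta> * z $ j"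
    and "rot i j \<theta> z $ j = sin \<theta> * z $ i + cos \<theta> * z $ j"
  using assms by (simp_all add: rot_def axis_def algebra_simps)

lemma norm_rot:
  assumes "i \<noteq> j"
  shows "norm (rot i j \<theta> z) = norm z"
proof -
  let ?c = "cos \<theta>" and ?s = "sin \<theta>" and ?a = "z $ i" and ?b = "z $ j"
  define w where "w = rot i j \<theta> z"
  have "w \<bullet> w = z \<bullet> w + ((?c - 1) * ?a - ?s * ?b) * w $ i + (?s * ?a + (?c - 1) * ?b) * w $ j"
    unfolding inner_commute[of z w] unfolding w_def by (rule inner_rot)
  also have "\<dots> = z \<bullet> z + ((?c - 1) * ?a - ?s * ?b) * ?a
       + (?s * ?a + (?c - 1) * ?b) * ?b
       + ((?c - 1) * ?a - ?s * ?b) * (?c * ?a - ?s * ?b) + (?s * ?a + (?c - 1) * ?b) * (?s * ?a + ?c * ?b)"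
    unfolding w_def inner_rot rot_nth[OF assms] ..
  also have "\<dots> = z \<bullet> z + (?c\<^sup>2 + ?s\<^sup>2 - 1) * (?a\<^sup>2 + ?b\<^sup>2)"
  proof -
    have "X + ((c - 1) * a - s * b) * a + (s * a + (c - 1) * b) * b
       + ((c - 1) * a - s * b) * (c * a - s * b) + (s * a + (c - 1) * b) * (s * a + c * b)
       - (X + (c\<^sup>2 + s\<^sup>2 - 1) * (a\<^sup>2 + b\<^sup>2)) = 0" for X a b c s :: real
      by (simp add: algebra_simps power2_eq_square)
    from this[of "z \<bullet> z" ?c ?a ?s ?b] show ?thesis
      by (simp only: eq_iff_diff_eq_0[symmetric])
  qed
  also have "?c\<^sup>2 + ?s\<^sup>2 = 1" by simp
  finally show ?thesis by (simp add: norm_eq_sqrt_inner w_def)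
qed

lemma rot_orthogonal:
  assumes "i \<noteq> j"
  shows "orthogonal_transformation (rot i j \<theta>)"
  unfolding orthogonal_transformation
proof
  show "linear (rot i j \<theta>)"
    by (rule linearI) (simp_all add: rot_def algebra_simps)
qed (simp add: norm_rot[OF assms])

lemma DERIV_inner_rot:
  assumes "i \<noteq> j"
  shows "((\<lambda>\<theta>. a \<bullet> rot i j \<theta> z) has_real_derivative
     (rot i j \<theta> z $ i * a $ j - rot i j \<theta> z $ j * a $ i)) (at \<theta>)"
  unfolding inner_rot rot_nth[OF assms]
  by (auto intro!: derivative_eq_intros simp: algebra_simps)

text \<open>Rotation invariance makes the generators of rotations skew-symmetric.\<close>

lemma integral_sphere_rot_deriv:
  fixes f D :: "real^'n \<Rightarrow> real"
  assumes ij: "i \<noteq> j"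
    and f: "continuous_on (sphere 0 1) f" and D: "continuous_on (sphere 0 1) D"
    and der: "\<And>z \<theta>. norm z = 1 \<Longrightarrow>
       ((\<lambda>\<theta>. f (rot i j \<theta> z)) has_real_derivative D (rot i j \<theta> z)) (at \<theta>)"
  shows "(\<integral>z. D z \<partial>sphere_measure) = 0"
proof -
  have "compact (D ` sphere 0 1)" by (rule compact_continuous_image[OF D]) simp
  then obtain B where B: "\<And>x. x \<in> sphere 0 1 \<Longrightarrow> \<bar>D x\<bar> \<le> B"
    by (metis bounded_iff compact_imp_bounded imageI real_norm_def)
  define h where "h n = 1 / real (Suc n)" for n
  \<comment> \<open>Difference quotients in the angle: invariance makes each integrate to zero, and
    the mean value theorem bounds them uniformly by the supremum of |D|.\<close>
  define s where "s n z = (f (rot i j (h n) z) - f z) / h n" for n z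
  have hpos: "h n > 0" for n by (simp add: h_def)
  have h0: "h \<longlonglongrightarrow> 0" unfolding h_def by (rule LIMSEQ_Suc[OF lim_1_over_n])
  have fm [measurable]: "f \<in> borel_measurable sphere_measure" by (rule measurable_sphere_continuous[OF f])
  have rm [measurable]: "rot i j \<theta> \<in> sphere_measure \<rightarrow>\<^sub>M sphere_measure" for \<theta>
    by (rule measurable_sphere_orthogonal[OF rot_orthogonal[OF ij]])
  have sm: "s n \<in> borel_measurable sphere_measure" for n
    unfolding s_def by measurable
  have "(\<lambda>n. \<integral>z. s n z \<partial>sphere_measure) \<longlonglongrightarrow> (\<integral>z. D z \<partial>sphere_measure)"
  proof (rule integral_dominated_convergence)
    show "D \<in> borel_measurable sphere_measure" by (rule measurable_sphere_continuous[OF D])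
    show "s n \<in> borel_measurable sphere_measure" for n by (rule sm)
    interpret finite_measure "sphere_measure :: (real^'n) measure" by (rule finite_measure_sphere)
    show "integrable (sphere_measure :: (real^'n) measure) (\<lambda>_. B)" by simp
    show "AE z in sphere_measure. (\<lambda>n. s n z) \<longlonglongrightarrow> D z"
    proof (rule AE_I2)
      fix z :: "real^'n" assume "z \<in> space sphere_measure"
      then have "((\<lambda>\<theta>. f (rot i j \<theta> z)) has_real_derivative D z) (at 0)"
        using der[of z 0] by simp
      then have "((\<lambda>\<theta>. (f (rot i j \<theta> z) - f z) / \<theta>) \<longlongrightarrow> D z) (at 0)"
        by (simp add: has_field_derivative_iff)
      moreover have "filterlim h (at 0) sequentially"
        using h0 hpos by (auto simp: filterlim_at less_imp_neq[symmetric])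
      ultimately show "(\<lambda>n. s n z) \<longlonglongrightarrow> D z"
        unfolding s_def by (rule filterlim_compose)
    qed
    show "AE z in sphere_measure. norm (s n z) \<le> B" for n
    proof (rule AE_I2)
      fix z :: "real^'n" assume z: "z \<in> space sphere_measure"
      then obtain \<theta> where "f (rot i j (h n) z) - f (rot i j 0 z) = (h n - 0) * D (rot i j \<theta> z)"
        using MVT2[OF hpos[of n], of "\<lambda>\<theta>. f (rot i j \<theta> z)" "\<lambda>\<theta>. D (rot i j \<theta> z)"] der[of z] by auto
      then have "s n z = D (rot i j \<theta> z)" using hpos[of n] by (simp add: s_def)
      then show "norm (s n z) \<le> B" using B[of "rot i j \<theta> z"] z by (simp add: norm_rot[OF ij])
    qed
  qed
  moreover have "(\<integral>z. s n z \<partial>sphere_measure) = 0" for n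
  proof -
    have i1: "integrable sphere_measure f" by (rule integrable_sphere_continuous[OF f])
    then have i2: "integrable sphere_measure (\<lambda>z. f (rot i j (h n) z))"
      using integrable_distr[OF rm, of "h n" f]
      by (simp add: distr_sphere_orthogonal[OF rot_orthogonal[OF ij]])
    show ?thesis
      using integral_sphere_orthogonal[OF rot_orthogonal[OF ij, of "h n"] fm] i1 i2
      by (simp add: s_def)
  qed
  ultimately show ?thesis by (simp add: LIMSEQ_const_iff)
qed

text \<open>\<open>L a z\<close> is the derivative of the inner product of a and z under the
  rotation. The product rule is applied to p (x.z) q (y.z) \<open>L y z\<close>. The additional
  factor \<open>L y z\<close> makes the first term, summed over all planes, an inner product of
  tangential gradients.\<close>

lemma integral_rot_zonal:
  fixes x y :: "real^'n" and p q :: "real poly" and i j :: 'n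
  defines "L \<equiv> \<lambda>a z. z $ i * a $ j - z $ j * a $ i"
  assumes "i \<noteq> j"
  shows "(\<integral>z. poly (pderiv p) (x \<bullet> z) * poly q (y \<bullet> z) * (L x z * L y z)
       + poly p (x \<bullet> z) * poly (pderiv q) (y \<bullet> z) * (L y z)\<^sup>2
       - poly p (x \<bullet> z) * poly q (y \<bullet> z) * (z $ i * y $ i + z $ j * y $ j) \<partial>sphere_measure) = 0"
proof (rule integral_sphere_rot_deriv[OF assms(2), where f = "\<lambda>z. poly p (x \<bullet> z) * poly q (y \<bullet> z) * L y z"])
  define b where "b = y $ j *\<^sub>R axis i 1 - y $ i *\<^sub>R (axis j 1 :: real^'n)"
  have Lb: "L y z = b \<bullet> z" for z
    by (simp add: L_def b_def inner_diff_right inner_commute[of _ z] inner_axis mult_ac)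
  have bi: "b $ i = y $ j" "b $ j = - y $ i"
    using assms(2) by (simp_all add: b_def axis_def)
  fix z :: "real^'n" and \<theta>
  define w where "w = rot i j \<theta> z"
  note d [derivative_intros] = DERIV_inner_rot[OF assms(2), of _ z \<theta>, THEN DERIV_chain2[OF poly_DERIV]]
  show "((\<lambda>\<theta>. poly p (x \<bullet> rot i j \<theta> z) * poly q (y \<bullet> rot i j \<theta> z) * L y (rot i j \<theta> z))
     has_real_derivative poly (pderiv p) (x \<bullet> rot i j \<theta> z) * poly q (y \<bullet> rot i j \<theta> z) * (L x (rot i j \<theta> z) * L y (rot i j \<theta> z))
       + poly p (x \<bullet> rot i j \<theta> z) * poly (pderiv q) (y \<bullet> rot i j \<theta> z) * (L y (rot i j \<theta> z))\<^sup>2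
       - poly p (x \<bullet> rot i j \<theta> z) * poly q (y \<bullet> rot i j \<theta> z)
          * (rot i j \<theta> z $ i * y $ i + rot i j \<theta> z $ j * y $ j)) (at \<theta>)"
    unfolding Lb
    apply (rule DERIV_cong)
     apply (rule DERIV_mult[OF DERIV_mult[OF d d] DERIV_inner_rot[OF assms(2)]])
    unfolding bi w_def[symmetric] Lb[symmetric] L_def
    by (simp add: algebra_simps power2_eq_square)
qed (auto simp: L_def intro!: continuous_intros)

text \<open>The polarised Lagrange identity; the factor 2 comes from ordered pairs. On the sphere it
  is twice the inner product of the tangential gradients of z -> x.z and z -> y.z.\<close>

lemma sum_rot_products:
  fixes x y z :: "real^'n"
  shows "(\<Sum>i\<in>UNIV. \<Sum>j\<in>UNIV. (z $ i * x $ j - z $ j * x $ i) * (z $ i * y $ j - z $ j * y $ i))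
      = 2 * ((z \<bullet> z) * (x \<bullet> y) - (x \<bullet> z) * (y \<bullet> z))"
proof -
  have "(z $ i * x $ j - z $ j * x $ i) * (z $ i * y $ j - z $ j * y $ i)
     = (z $ i * z $ i) * (x $ j * y $ j) - (y $ i * z $ i) * (x $ j * z $ j)
       - (x $ i * z $ i) * (y $ j * z $ j) + (x $ i * y $ i) * (z $ j * z $ j)" for i j
    by (simp add: algebra_simps)
  then show ?thesis
    by (simp add: sum.distrib sum_subtractf inner_vec_def flip: sum_product)
qed

lemma sum_rot_diag:
  fixes y z :: "real^'n"
  shows "(\<Sum>i\<in>UNIV. \<Sum>j\<in>UNIV. if i = j then 0 else z $ i * y $ i + z $ j * y $ j)
      = 2 * (real CARD('n) - 1) * (y \<bullet> z)"
proof -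
  have "(if i = j then 0 else z $ i * y $ i + z $ j * y $ j)
     = z $ i * y $ i + z $ j * y $ j - (if i = j then 2 * (z $ i * y $ i) else 0)" for i j
    by simp
  then show ?thesis
    by (simp add: sum.distrib sum_subtractf inner_vec_def mult.commute flip: sum_distrib_left)
       (simp add: algebra_simps)
qed

text \<open>Integration by parts for the Laplace-Beltrami operator, obtained by summing over all
  rotation planes. If q is the derivative of Q, the bracket multiplied by p is, for unit y, that
  operator applied to z -> Q (y.z).\<close>

lemma integral_zonal_by_parts:
  fixes x y :: "real^'n" and p q :: "real poly"
  shows "(\<integral>z. poly (pderiv p) (x \<bullet> z) * poly q (y \<bullet> z) * (x \<bullet> y - (x \<bullet> z) * (y \<bullet> z))
     + poly p (x \<bullet> z) * ((y \<bullet> y - (y \<bullet> z)\<^sup>2) * poly (pderiv q) (y \<bullet> z)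
           - (real CARD('n) - 1) * (y \<bullet> z) * poly q (y \<bullet> z)) \<partial>sphere_measure) = 0"
proof -
  define L where "L = (\<lambda>i j (a::real^'n) z. z $ i * a $ j - z $ j * a $ i)"
  \<comment> \<open>The diagonal pairs give no rotation. There \<open>L\<close> vanishes and the
    last factor is set to 0, so that the sum can run over all pairs.\<close>
  define F where "F = (\<lambda>i j z. poly (pderiv p) (x \<bullet> z) * poly q (y \<bullet> z) * (L i j x z * L i j y z)
       + poly p (x \<bullet> z) * poly (pderiv q) (y \<bullet> z) * (L i j y z * L i j y z)
       - poly p (x \<bullet> z) * poly q (y \<bullet> z) * (if i = j then 0 else z $ i * y $ i + z $ j * y $ j))"
  have F0: "(\<integral>z. F i j z \<partial>sphere_measure) = 0" for i j
  proof (cases "i = j")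
    case True
    then show ?thesis by (simp add: F_def L_def)
  next
    case False
    then show ?thesis using integral_rot_zonal[OF False, of p x q y]
      by (simp add: F_def L_def power2_eq_square)
  qed
  have Fi: "integrable sphere_measure (F i j)" for i j
    unfolding F_def L_def by (intro integrable_sphere_continuous) (cases "i = j"; auto intro!: continuous_intros)
  have "(\<integral>z. (\<Sum>i\<in>UNIV. \<Sum>j\<in>UNIV. F i j z) \<partial>sphere_measure) = 0"
    by (simp add: Bochner_Integration.integral_sum Fi F0)
  also have "(\<integral>z. (\<Sum>i\<in>UNIV. \<Sum>j\<in>UNIV. F i j z) \<partial>sphere_measure) =
    (\<integral>z. 2 * (poly (pderiv p) (x \<bullet> z) * poly q (y \<bullet> z) * (x \<bullet> y - (x \<bullet> z) * (y \<bullet> z))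
     + poly p (x \<bullet> z) * ((y \<bullet> y - (y \<bullet> z)\<^sup>2) * poly (pderiv q) (y \<bullet> z)
           - (real CARD('n) - 1) * (y \<bullet> z) * poly q (y \<bullet> z))) \<partial>sphere_measure)"
  proof (rule Bochner_Integration.integral_cong[OF refl])
    fix z :: "real^'n" assume "z \<in> space sphere_measure"
    then have zz: "z \<bullet> z = 1" by (simp add: norm_eq_1)
    have "(\<Sum>i\<in>UNIV. \<Sum>j\<in>UNIV. F i j z)
       = poly (pderiv p) (x \<bullet> z) * poly q (y \<bullet> z) * (\<Sum>i\<in>UNIV. \<Sum>j\<in>UNIV. L i j x z * L i j y z)
       + poly p (x \<bullet> z) * poly (pderiv q) (y \<bullet> z) * (\<Sum>i\<in>UNIV. \<Sum>j\<in>UNIV. L i j y z * L i j y z)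
       - poly p (x \<bullet> z) * poly q (y \<bullet> z) *
          (\<Sum>i\<in>UNIV. \<Sum>j\<in>UNIV. if i = j then 0 else z $ i * y $ i + z $ j * y $ j)"
      unfolding F_def sum.distrib sum_subtractf sum_distrib_left ..
    then show "(\<Sum>i\<in>UNIV. \<Sum>j\<in>UNIV. F i j z) =
      2 * (poly (pderiv p) (x \<bullet> z) * poly q (y \<bullet> z) * (x \<bullet> y - (x \<bullet> z) * (y \<bullet> z))
     + poly p (x \<bullet> z) * ((y \<bullet> y - (y \<bullet> z)\<^sup>2) * poly (pderiv q) (y \<bullet> z)
           - (real CARD('n) - 1) * (y \<bullet> z) * poly q (y \<bullet> z)))"
      unfolding L_def sum_rot_products sum_rot_diag zz
      by (simp add: algebra_simps power2_eq_square)
  qed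
  finally show ?thesis unfolding integral_mult_right_zero by simp
qed

text \<open>The Dirichlet form \<open>W\<close> equals the eigenvalue m (m + 2\<nu>) times the inner
  product \<open>G\<close>. Both are symmetric under exchanging the two functions, so distinct
  eigenvalues force \<open>G\<close> to vanish.\<close>

lemma zonal_orthogonal:
  fixes x y :: "real^'n"
  assumes d: "CARD('n) \<ge> 2" and xy: "norm x = 1" "norm y = 1" and nm: "n \<noteq> m"
  shows "(\<integral>z. zonal (gnu CARD('n)) n (x \<bullet> z) * zonal (gnu CARD('n)) m (y \<bullet> z) \<partial>sphere_measure) = 0"
proof -
  define \<nu> where "\<nu> = gnu CARD('n)"
  have nu: "\<nu> \<ge> 0" "real CARD('n) - 1 = 2 * \<nu> + 1"
    using d by (simp_all add: \<nu>_def gnu_def field_simps)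
  define G where "G = (\<lambda>n m x y. \<integral>z. poly (zonal_poly \<nu> n) (x \<bullet> z) * poly (zonal_poly \<nu> m) (y \<bullet> z) \<partial>(sphere_measure :: (real^'n) measure))"
  define W where "W = (\<lambda>n m x y. \<integral>z. poly (pderiv (zonal_poly \<nu> n)) (x \<bullet> z) * poly (pderiv (zonal_poly \<nu> m)) (y \<bullet> z)
        * (x \<bullet> y - (x \<bullet> z) * (y \<bullet> z)) \<partial>(sphere_measure :: (real^'n) measure))"
  have WG: "W n m x y = real m * (real m + 2 * \<nu>) * G n m x y" if "norm y = 1" for n m x y
  proof -
    have yy: "y \<bullet> y = 1" using that by (simp add: norm_eq_1)
    have "(1 - (y \<bullet> z)\<^sup>2) * poly (pderiv (pderiv (zonal_poly \<nu> m))) (y \<bullet> z)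
           - (real CARD('n) - 1) * (y \<bullet> z) * poly (pderiv (zonal_poly \<nu> m)) (y \<bullet> z)
        = - (real m * (real m + 2 * \<nu>) * poly (zonal_poly \<nu> m) (y \<bullet> z))" for z
      using zonal_poly_ode[of "y \<bullet> z" \<nu> m] unfolding nu(2) by simp
    then have "(\<integral>z. poly (pderiv (zonal_poly \<nu> n)) (x \<bullet> z) * poly (pderiv (zonal_poly \<nu> m)) (y \<bullet> z)
        * (x \<bullet> y - (x \<bullet> z) * (y \<bullet> z)) - real m * (real m + 2 * \<nu>) *
          (poly (zonal_poly \<nu> n) (x \<bullet> z) * poly (zonal_poly \<nu> m) (y \<bullet> z)) \<partial>sphere_measure) = 0"
      using integral_zonal_by_parts[of "zonal_poly \<nu> n" x "pderiv (zonal_poly \<nu> m)" y]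
      unfolding yy by (simp add: mult_ac)
    moreover have "integrable sphere_measure (\<lambda>z. poly (pderiv (zonal_poly \<nu> n)) (x \<bullet> z)
        * poly (pderiv (zonal_poly \<nu> m)) (y \<bullet> z) * (x \<bullet> y - (x \<bullet> z) * (y \<bullet> z)))"
      by (intro integrable_sphere_continuous continuous_intros)
    moreover have "integrable sphere_measure (\<lambda>z. real m * (real m + 2 * \<nu>) *
          (poly (zonal_poly \<nu> n) (x \<bullet> z) * poly (zonal_poly \<nu> m) (y \<bullet> z)))"
      by (intro integrable_sphere_continuous continuous_intros)
    ultimately show ?thesis unfolding W_def G_def by simp
  qed
  have "W n m x y = W m n y x" unfolding W_def
    by (intro Bochner_Integration.integral_cong) (simp_all add: inner_commute[of x y] mult_ac)
  moreover have "G n m x y = G m n y x" unfolding G_def by (simp add: mult.commute)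
  ultimately have "(real m * (real m + 2 * \<nu>) - real n * (real n + 2 * \<nu>)) * G n m x y = 0"
    using WG[OF xy(2), of n m x] WG[OF xy(1), of m n y] by (simp add: left_diff_distrib)
  moreover have "real m * (real m + 2 * \<nu>) - real n * (real n + 2 * \<nu>) = (real m - real n) * (real m + real n + 2 * \<nu>)"
    by (simp add: algebra_simps)
  \<comment> \<open>When \<nu> = 0 this could fail only for m = n = 0, which distinct degrees
    exclude.\<close>
  moreover have "real m + real n + 2 * \<nu> > 0" using nm nu by (cases m; cases n) auto
  ultimately have "G n m x y = 0" using nm by simp
  then show ?thesis
    unfolding G_def zonal_eq_poly[OF nu(1), symmetric] unfolding \<nu>_def .
qed

section \<open>The Poisson kernel and completeness\<close>

text \<open>Agrees with \<open>qker\<close> on unit vectors for d at least 2, but is a polynomial in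
  the inner product there, which makes continuity and joint measurability immediate.\<close>

definition zker :: "nat \<Rightarrow> real^'n \<Rightarrow> real^'n \<Rightarrow> real" where
  "zker n x y = zonal (gnu CARD('n)) n (x \<bullet> y) / sphere_area CARD('n)"

definition zproj :: "nat \<Rightarrow> (real^'n \<Rightarrow> real) \<Rightarrow> real^'n \<Rightarrow> real" where
  "zproj n f x = (\<integral>y. zker n x y * f y \<partial>sphere_measure)"

text \<open>The exponent is d/2, and for unit vectors the base is the squared distance from x to r
  y: this is the Poisson kernel of the unit ball.\<close>

definition pois :: "real \<Rightarrow> real^'n \<Rightarrow> real^'n \<Rightarrow> real" where
  "pois r x y = (1 - r\<^sup>2) * (1 - 2 * r * (x \<bullet> y) + r\<^sup>2) powr (- (gnu CARD('n) + 1)) / sphere_area CARD('n)"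

text \<open>Bounded measurable functions are closed under sums, products and the projections, and
  are integrable because the measure is finite.\<close>

definition sphere_bm :: "(real^'n \<Rightarrow> real) \<Rightarrow> bool" where
  "sphere_bm f \<longleftrightarrow> f \<in> borel_measurable sphere_measure \<and> (\<exists>B. \<forall>x. norm x = 1 \<longrightarrow> \<bar>f x\<bar> \<le> B)"

lemma gnu_nonneg: "d \<ge> 2 \<Longrightarrow> gnu d \<ge> 0"
  by (simp add: gnu_def)

lemma area_pos: "sphere_area CARD('n::finite) > 0"
  by (rule sphere_area_pos) simp

lemma abs_inner_le_1: "norm x = 1 \<Longrightarrow> norm y = 1 \<Longrightarrow> \<bar>x \<bullet> y\<bar> \<le> 1" for x y :: "'a::real_inner"
  using Cauchy_Schwarz_ineq2[of x y] by simp

lemma zker_commute: "zker n x y = zker n y x"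
  by (simp add: zker_def inner_commute)

lemma abs_zker_le:
  fixes x y :: "real^'n"
  assumes "CARD('n) \<ge> 2" "norm x = 1" "norm y = 1"
  shows "\<bar>zker n x y\<bar> \<le> zonal_bound (gnu CARD('n)) n / sphere_area CARD('n)"
  using abs_zonal_le[OF gnu_nonneg[OF assms(1)] abs_inner_le_1[OF assms(2,3)], of n] area_pos[where 'n='n]
  by (simp add: zker_def divide_right_mono)

lemma zonal_bound_nonneg: "\<nu> \<ge> 0 \<Longrightarrow> zonal_bound \<nu> n \<ge> 0"
  using abs_zonal_le[of \<nu> 0 n] by linarith

lemma continuous_on_zker:
  fixes x :: "real^'n"
  assumes "CARD('n) \<ge> 2"
  shows "continuous_on S (zker n x)"
  unfolding zker_def zonal_eq_poly[OF gnu_nonneg[OF assms]]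
  using area_pos[where 'n='n] by (intro continuous_intros) auto

lemma measurable_zker_pair:
  assumes "CARD('n) \<ge> 2"
  shows "(\<lambda>p. zker n (fst p) (snd p)) \<in> borel_measurable ((sphere_measure :: (real^'n) measure) \<Otimes>\<^sub>M sphere_measure)"
proof -
  have [measurable]: "(\<lambda>x. x) \<in> (sphere_measure :: (real^'n) measure) \<rightarrow>\<^sub>M borel"
    by (rule measurable_sphere_borel) simp
  have [measurable]: "poly p \<in> borel_measurable borel" for p :: "real poly"
    by (intro borel_measurable_continuous_onI continuous_intros)
  have [measurable]: "fst \<in> (sphere_measure :: (real^'n) measure) \<Otimes>\<^sub>M (sphere_measure :: (real^'n) measure) \<rightarrow>\<^sub>M borel"
    using measurable_compose[OF measurable_fst \<open>(\<lambda>x. x) \<in> (sphere_measure :: (real^'n) measure) \<rightarrow>\<^sub>M borel\<close>] .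
  have [measurable]: "snd \<in> (sphere_measure :: (real^'n) measure) \<Otimes>\<^sub>M (sphere_measure :: (real^'n) measure) \<rightarrow>\<^sub>M borel"
    using measurable_compose[OF measurable_snd \<open>(\<lambda>x. x) \<in> (sphere_measure :: (real^'n) measure) \<rightarrow>\<^sub>M borel\<close>] .
  show ?thesis
    unfolding zker_def zonal_eq_poly[OF gnu_nonneg[OF assms]] by measurable
qed

lemma sphere_bmD: "sphere_bm f \<Longrightarrow> f \<in> borel_measurable sphere_measure"
  by (simp add: sphere_bm_def)

lemma sphere_bm_integrable: "sphere_bm f \<Longrightarrow> integrable sphere_measure f"
  unfolding sphere_bm_def using integrable_sphere_bounded by blast

lemma sphere_bm_continuous:
  fixes f :: "real^'n \<Rightarrow> real"
  assumes "continuous_on (sphere 0 1) f"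
  shows "sphere_bm f"
proof -
  have "compact (f ` sphere 0 1)" by (rule compact_continuous_image[OF assms]) simp
  then obtain B where "\<And>x. x \<in> sphere 0 1 \<Longrightarrow> norm (f x) \<le> B"
    by (meson bounded_iff compact_imp_bounded imageI)
  then show ?thesis
    using measurable_sphere_continuous[OF assms] by (auto simp: sphere_bm_def)
qed

lemma sphere_bm_const: "sphere_bm (\<lambda>_. c)"
  by (auto simp: sphere_bm_def)

lemma sphere_bm_mult: "sphere_bm f \<Longrightarrow> sphere_bm g \<Longrightarrow> sphere_bm (\<lambda>x. f x * g x)"
proof -
  assume f: "sphere_bm f" and g: "sphere_bm g"
  then obtain B C where "\<And>x. norm x = 1 \<Longrightarrow> \<bar>f x\<bar> \<le> B" "\<And>x. norm x = 1 \<Longrightarrow> \<bar>g x\<bar> \<le> C"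
    unfolding sphere_bm_def by metis
  then have "\<bar>f x * g x\<bar> \<le> B * C" if "norm x = 1" for x
    unfolding abs_mult using that by (intro mult_mono) (auto intro: order_trans[OF abs_ge_zero])
  with f g show ?thesis by (auto simp: sphere_bm_def)
qed

lemma sphere_bm_add: "sphere_bm f \<Longrightarrow> sphere_bm g \<Longrightarrow> sphere_bm (\<lambda>x. f x + g x)"
proof -
  assume f: "sphere_bm f" and g: "sphere_bm g"
  then obtain B C where "\<And>x. norm x = 1 \<Longrightarrow> \<bar>f x\<bar> \<le> B" "\<And>x. norm x = 1 \<Longrightarrow> \<bar>g x\<bar> \<le> C"
    unfolding sphere_bm_def by metis
  then have "\<bar>f x + g x\<bar> \<le> B + C" if "norm x = 1" for x
    using that by (meson abs_triangle_ineq add_mono order_trans)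
  with f g show ?thesis by (auto simp: sphere_bm_def)
qed

lemma sphere_bm_sum: "(\<And>i. i \<in> I \<Longrightarrow> sphere_bm (f i)) \<Longrightarrow> sphere_bm (\<lambda>x. \<Sum>i\<in>I. f i x)"
  by (induction I rule: infinite_finite_induct) (auto intro: sphere_bm_const sphere_bm_add)

lemma sphere_bm_diff: "sphere_bm f \<Longrightarrow> sphere_bm g \<Longrightarrow> sphere_bm (\<lambda>x. f x - g x)"
  using sphere_bm_add[of f "\<lambda>x. -1 * g x"] sphere_bm_mult[OF sphere_bm_const, of g "-1"] by simp

lemma sphere_bm_zker:
  fixes x :: "real^'n"
  shows "CARD('n) \<ge> 2 \<Longrightarrow> sphere_bm (zker n x)"
  by (intro sphere_bm_continuous continuous_on_zker)

section \<open>The projections as bounded symmetric operators\<close>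

lemma zproj_bound:
  fixes f :: "real^'n \<Rightarrow> real"
  assumes d: "CARD('n) \<ge> 2" and B: "\<And>x. norm x = 1 \<Longrightarrow> \<bar>f x\<bar> \<le> B" and f: "f \<in> borel_measurable sphere_measure"
    and x: "norm x = 1"
  shows "\<bar>zproj n f x\<bar> \<le> zonal_bound (gnu CARD('n)) n * B"
proof -
  interpret finite_measure "sphere_measure :: (real^'n) measure" by (rule finite_measure_sphere)
  let ?C = "zonal_bound (gnu CARD('n)) n / sphere_area CARD('n)"
  have C: "?C \<ge> 0" using zonal_bound_nonneg[OF gnu_nonneg[OF d], of n] area_pos[where 'n='n] by simp
  have "sphere_bm f" using B f by (auto simp: sphere_bm_def)
  then have i: "integrable sphere_measure (\<lambda>y. zker n x y * f y)"
    by (intro sphere_bm_integrable sphere_bm_mult sphere_bm_zker d)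
  have "\<bar>zproj n f x\<bar> \<le> (\<integral>y. \<bar>zker n x y * f y\<bar> \<partial>sphere_measure)"
    unfolding zproj_def by (rule integral_abs_bound)
  also have "\<dots> \<le> (\<integral>y. ?C * B \<partial>(sphere_measure :: (real^'n) measure))"
  proof (rule integral_mono)
    fix y :: "real^'n" assume "y \<in> space sphere_measure"
    then have y: "norm y = 1" by simp
    show "\<bar>zker n x y * f y\<bar> \<le> ?C * B"
      unfolding abs_mult using abs_zker_le[OF d x y, of n] B[OF y] C by (intro mult_mono) auto
  qed (use i in auto)
  also have "\<dots> = zonal_bound (gnu CARD('n)) n * B"
    using area_pos[where 'n='n] by (simp add: measure_sphere_measure)
  finally show ?thesis .
qed

lemma sphere_bm_zproj:
  fixes f :: "real^'n \<Rightarrow> real"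
  assumes d: "CARD('n) \<ge> 2" and f: "sphere_bm f"
  shows "sphere_bm (zproj n f)"
proof -
  interpret finite_measure "sphere_measure :: (real^'n) measure" by (rule finite_measure_sphere)
  note [measurable] = measurable_zker_pair[OF d] sphere_bmD[OF f]
  have "(\<lambda>p. zker n (fst p) (snd p) * f (snd p)) \<in> borel_measurable ((sphere_measure :: (real^'n) measure) \<Otimes>\<^sub>M sphere_measure)"
    by measurable
  then have "(\<lambda>x. \<integral>y. zker n x y * f y \<partial>sphere_measure) \<in> borel_measurable sphere_measure"
    by (intro borel_measurable_lebesgue_integral) (simp add: case_prod_beta')
  then have "zproj n f \<in> borel_measurable sphere_measure"
    unfolding zproj_def[abs_def] .
  moreover obtain B where "\<And>x. norm x = 1 \<Longrightarrow> \<bar>f x\<bar> \<le> B" using f by (auto simp: sphere_bm_def)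
  ultimately show ?thesis
    using zproj_bound[OF d _ sphere_bmD[OF f]] unfolding sphere_bm_def by blast
qed

lemma sphere_Fubini:
  fixes h :: "real^'n \<Rightarrow> real^'n \<Rightarrow> real"
  assumes m: "(\<lambda>p. h (fst p) (snd p)) \<in> borel_measurable (sphere_measure \<Otimes>\<^sub>M sphere_measure)"
    and b: "\<And>x y. norm x = 1 \<Longrightarrow> norm y = 1 \<Longrightarrow> \<bar>h x y\<bar> \<le> B"
  shows "(\<integral>x. (\<integral>y. h x y \<partial>sphere_measure) \<partial>sphere_measure) = (\<integral>y. (\<integral>x. h x y \<partial>sphere_measure) \<partial>sphere_measure)"
proof -
  interpret finite_measure "sphere_measure :: (real^'n) measure" by (rule finite_measure_sphere)
  interpret P: pair_sigma_finite "sphere_measure :: (real^'n) measure" "sphere_measure :: (real^'n) measure" ..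
  interpret PF: finite_measure "(sphere_measure :: (real^'n) measure) \<Otimes>\<^sub>M (sphere_measure :: (real^'n) measure)"
    by (intro finite_measure_pair_measure finite_measure_sphere)
  have "integrable (sphere_measure \<Otimes>\<^sub>M sphere_measure) (\<lambda>p. h (fst p) (snd p))"
    using m b by (intro PF.integrable_const_bound[of _ B]) (auto simp: space_pair_measure)
  then show ?thesis
    by (intro P.Fubini_integral[symmetric]) (simp add: case_prod_beta')
qed

lemma zproj_symmetric:
  fixes f g :: "real^'n \<Rightarrow> real"
  assumes d: "CARD('n) \<ge> 2" and f: "sphere_bm f" and g: "sphere_bm g"
  shows "(\<integral>x. zproj n f x * g x \<partial>sphere_measure) = (\<integral>x. f x * zproj n g x \<partial>sphere_measure)"
proof -
  note [measurable] = measurable_zker_pair[OF d] sphere_bmD[OF f] sphere_bmD[OF g]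
  obtain B where B: "\<And>x. norm x = 1 \<Longrightarrow> \<bar>f x\<bar> \<le> B" using f by (auto simp: sphere_bm_def)
  obtain C where C: "\<And>x. norm x = 1 \<Longrightarrow> \<bar>g x\<bar> \<le> C" using g by (auto simp: sphere_bm_def)
  have "(\<integral>x. (\<integral>y. zker n x y * f y * g x \<partial>sphere_measure) \<partial>sphere_measure)
     = (\<integral>y. (\<integral>x. zker n x y * f y * g x \<partial>sphere_measure) \<partial>sphere_measure)"
  proof (rule sphere_Fubini)
    show "(\<lambda>p. zker n (fst p) (snd p) * f (snd p) * g (fst p)) \<in> borel_measurable (sphere_measure \<Otimes>\<^sub>M sphere_measure)"
      by measurable
    fix x y :: "real^'n" assume xy: "norm x = 1" "norm y = 1"
    have 1: "\<bar>zker n x y\<bar> \<le> zonal_bound (gnu CARD('n)) n / sphere_area CARD('n)" and 2: "\<bar>f y\<bar> \<le> B"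
      using abs_zker_le[OF d xy] B xy by auto
    have "zonal_bound (gnu CARD('n)) n / sphere_area CARD('n) * B \<ge> 0"
      by (intro mult_nonneg_nonneg order_trans[OF abs_ge_zero 1] order_trans[OF abs_ge_zero 2])
    then show "\<bar>zker n x y * f y * g x\<bar> \<le> zonal_bound (gnu CARD('n)) n / sphere_area CARD('n) * B * C"
      unfolding abs_mult using 1 2 C[OF xy(1)]
      by (intro mult_mono) (auto intro: order_trans[OF abs_ge_zero])
  qed
  moreover have "(\<integral>y. zker n x y * f y * g x \<partial>sphere_measure) = zproj n f x * g x" for x
    unfolding zproj_def by simp
  moreover have "(\<integral>x. zker n x y * f y * g x \<partial>sphere_measure) = f y * zproj n g y" for y
    unfolding zproj_def by (subst integral_mult_right_zero[symmetric], rule Bochner_Integration.integral_cong)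
       (simp_all add: zker_commute[of n y] mult_ac)
  ultimately show ?thesis by (simp only:)
qed

lemma zker_orthogonal:
  fixes x y :: "real^'n"
  assumes "CARD('n) \<ge> 2" "norm x = 1" "norm y = 1" "n \<noteq> m"
  shows "(\<integral>z. zker n x z * zker m z y \<partial>sphere_measure) = 0"
proof -
  have "(\<integral>z. zker n x z * zker m z y \<partial>sphere_measure)
     = (\<integral>z. zonal (gnu CARD('n)) n (x \<bullet> z) * zonal (gnu CARD('n)) m (y \<bullet> z) / (sphere_area CARD('n) * sphere_area CARD('n)) \<partial>sphere_measure)"
    by (simp add: zker_def inner_commute[of _ y])
  then show ?thesis using zonal_orthogonal[OF assms] by simp
qed

section \<open>Poisson means and their limit\<close>

lemma pois_sums:
  fixes x y :: "real^'n"
  assumes "CARD('n) \<ge> 2" "norm x = 1" "norm y = 1" "0 \<le> r" "r < 1"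
  shows "(\<lambda>n. r ^ n * zker n x y) sums pois r x y"
  using sums_divide[OF zonal_sums[OF gnu_nonneg[OF assms(1)] abs_inner_le_1[OF assms(2,3)] assms(4,5)], of "sphere_area CARD('n)"]
  by (simp add: zker_def pois_def mult_ac)

lemma pois_nonneg: "0 \<le> r \<Longrightarrow> r < 1 \<Longrightarrow> pois r x y \<ge> 0" for x y :: "real^'n"
  using area_pos[where 'n='n] by (auto simp: pois_def abs_square_le_1 power_le_one intro!: divide_nonneg_pos mult_nonneg_nonneg)

lemma continuous_on_pois:
  fixes x :: "real^'n"
  assumes "norm x = 1" "0 \<le> r" "r < 1"
  shows "continuous_on (sphere 0 1) (pois r x)"
proof -
  have "1 - 2 * r * (x \<bullet> y) + r\<^sup>2 \<noteq> 0" if "norm y = 1" for y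
  proof -
    have "2 * r * (x \<bullet> y) \<le> 2 * r * 1"
      using abs_inner_le_1[OF assms(1) that] assms(2) by (intro mult_left_mono) auto
    moreover have "(1 - r)\<^sup>2 > 0" using assms by simp
    ultimately show ?thesis by (simp add: power2_eq_square algebra_simps)
  qed
  then show ?thesis
    unfolding pois_def using area_pos[where 'n='n] by (intro continuous_intros) auto
qed

lemma zproj_sums_pois:
  fixes f :: "real^'n \<Rightarrow> real"
  assumes d: "CARD('n) \<ge> 2" and f: "sphere_bm f" and x: "norm x = 1" and r: "0 \<le> r" "r < 1"
  shows "(\<lambda>n. r ^ n * zproj n f x) sums (\<integral>y. pois r x y * f y \<partial>sphere_measure)"
proof -
  interpret finite_measure "sphere_measure :: (real^'n) measure" by (rule finite_measure_sphere)
  obtain B where B: "\<And>x. norm x = 1 \<Longrightarrow> \<bar>f x\<bar> \<le> B" using f by (auto simp: sphere_bm_def)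
  have B0: "B \<ge> 0" using B[OF x] by linarith
  let ?h = "\<lambda>n y. r ^ n * (zker n x y * f y)"
  define b where "b n = zonal_bound (gnu CARD('n)) n * r ^ n * (B / sphere_area CARD('n))" for n
  have sb: "summable b"
    unfolding b_def by (intro summable_mult2 summable_zonal_bound gnu_nonneg d r)
  have hb: "norm (?h n y) \<le> b n" if "norm y = 1" for n y
  proof -
    have "norm (?h n y) = r ^ n * (\<bar>zker n x y\<bar> * \<bar>f y\<bar>)" using r by (simp add: abs_mult)
    also have "\<dots> \<le> r ^ n * (zonal_bound (gnu CARD('n)) n / sphere_area CARD('n) * B)"
      using r abs_zker_le[OF d x that, of n] B[OF that] B0
      by (intro mult_left_mono mult_mono) (auto intro: order_trans[OF abs_ge_zero])
    finally show ?thesis by (simp add: b_def mult_ac)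
  qed
  have hi: "integrable sphere_measure (?h n)" for n
    by (intro integrable_mult_right sphere_bm_integrable sphere_bm_mult sphere_bm_zker d f)
  have "(\<lambda>n. \<integral>y. ?h n y \<partial>sphere_measure) sums (\<integral>y. (\<Sum>n. ?h n y) \<partial>sphere_measure)"
  proof (rule sums_integral[OF hi])
    show "AE y in sphere_measure. summable (\<lambda>n. norm (?h n y))"
      using hb by (intro AE_I2 summable_comparison_test'[OF sb, of 0]) auto
    show "summable (\<lambda>n. \<integral>y. norm (?h n y) \<partial>sphere_measure)"
    proof (rule summable_comparison_test'[OF summable_mult2[OF sb, of "sphere_area CARD('n)"], of 0])
      fix n
      have "(\<integral>y. norm (?h n y) \<partial>sphere_measure) \<le> (\<integral>y. b n \<partial>(sphere_measure :: (real^'n) measure))"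
        using hi[of n] hb by (intro integral_mono) auto
      then show "norm (\<integral>y. norm (?h n y) \<partial>sphere_measure) \<le> b n * sphere_area CARD('n)"
        by (simp add: measure_sphere_measure mult.commute)
    qed
  qed
  moreover have "(\<integral>y. ?h n y \<partial>sphere_measure) = r ^ n * zproj n f x" for n
    by (simp add: zproj_def)
  moreover have "(\<integral>y. (\<Sum>n. ?h n y) \<partial>sphere_measure) = (\<integral>y. pois r x y * f y \<partial>sphere_measure)"
  proof (rule Bochner_Integration.integral_cong[OF refl])
    fix y :: "real^'n" assume "y \<in> space sphere_measure"
    then have "(\<lambda>n. r ^ n * zker n x y * f y) sums (pois r x y * f y)"
      by (intro sums_mult2 pois_sums d x r) simp
    then show "(\<Sum>n. ?h n y) = pois r x y * f y" by (simp add: sums_iff mult.assoc)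
  qed
  ultimately show ?thesis by (simp only:)
qed

text \<open>The constant 1 is a multiple of the kernel of degree 0, so by orthogonality only that
  degree survives in the expansion; the integral is never computed directly.\<close>

lemma integral_pois:
  fixes x :: "real^'n"
  assumes d: "CARD('n) \<ge> 2" and x: "norm x = 1" and r: "0 \<le> r" "r < 1"
  shows "(\<integral>y. pois r x y \<partial>sphere_measure) = 1"
proof -
  have A: "sphere_area CARD('n) \<noteq> 0" using area_pos[where 'n='n] by simp
  have "zproj n (\<lambda>_. 1) x = (if n = 0 then 1 else 0)" for n
  proof (cases "n = 0")
    case True
    then show ?thesis using A by (simp add: zproj_def zker_def measure_sphere_measure)
  next
    case False
    have "(\<integral>z. zker n x z * zker 0 z x \<partial>sphere_measure) = 0"
      by (rule zker_orthogonal[OF d x x False])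
    then show ?thesis using A False by (simp add: zproj_def) (simp add: zker_def)
  qed
  then have "(\<lambda>n. r ^ n * zproj n (\<lambda>_. 1) x) = (\<lambda>n. if n = 0 then 1 else 0)"
    by auto
  moreover have "(\<lambda>n::nat. if n = 0 then 1 else 0 :: real) sums 1"
    using sums_single[of 0 "\<lambda>_. 1 :: real"] by simp
  ultimately have "(\<lambda>n. r ^ n * zproj n (\<lambda>_. 1) x) sums 1" by simp
  moreover have "(\<lambda>n. r ^ n * zproj n (\<lambda>_. 1) x) sums (\<integral>y. pois r x y * 1 \<partial>sphere_measure)"
    by (rule zproj_sums_pois[OF d sphere_bm_const x r])
  ultimately show ?thesis using sums_unique2 by fastforce
qed

text \<open>A common form for two estimates: c is the share absorbed by the mass one of the kernel,
  g the share bounded outright. It serves with g = 0 for the uniform bound and with a small c for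
  the approximate identity.\<close>

lemma abs_integral_pois_le:
  fixes f :: "real^'n \<Rightarrow> real"
  assumes d: "CARD('n) \<ge> 2" and x: "norm x = 1" and r: "0 \<le> r" "r < 1"
    and f: "f \<in> borel_measurable sphere_measure" and g: "integrable sphere_measure g"
    and le: "\<And>y. norm y = 1 \<Longrightarrow> \<bar>pois r x y * f y\<bar> \<le> c * pois r x y + g y"
  shows "\<bar>\<integral>y. pois r x y * f y \<partial>sphere_measure\<bar> \<le> c + (\<integral>y. g y \<partial>sphere_measure)"
proof -
  have pi: "integrable sphere_measure (pois r x)"
    by (intro integrable_sphere_continuous continuous_on_pois x r)
  note [measurable] = f measurable_sphere_continuous[OF continuous_on_pois[OF x r]]
  have i: "integrable sphere_measure (\<lambda>y. c * pois r x y + g y)" using pi g by simp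
  have "integrable sphere_measure (\<lambda>y. pois r x y * f y)"
  proof (rule Bochner_Integration.integrable_bound[OF i])
    show "AE y in sphere_measure. norm (pois r x y * f y) \<le> norm (c * pois r x y + g y)"
    proof (rule AE_I2)
      fix y :: "real^'n" assume "y \<in> space sphere_measure"
      then show "norm (pois r x y * f y) \<le> norm (c * pois r x y + g y)"
        using le[of y] by simp
    qed
  qed measurable
  then have "\<bar>\<integral>y. pois r x y * f y \<partial>sphere_measure\<bar> \<le> (\<integral>y. c * pois r x y + g y \<partial>sphere_measure)"
    using i le by (intro order_trans[OF integral_abs_bound] integral_mono) auto
  also have "\<dots> = c + (\<integral>y. g y \<partial>sphere_measure)"
    using pi g by (simp add: integral_pois[OF d x r])
  finally show ?thesis .
qed

lemma abs_integral_pois_bounded: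
  fixes f :: "real^'n \<Rightarrow> real"
  assumes d: "CARD('n) \<ge> 2" and x: "norm x = 1" and r: "0 \<le> r" "r < 1"
    and f: "f \<in> borel_measurable sphere_measure" and B: "\<And>y. norm y = 1 \<Longrightarrow> \<bar>f y\<bar> \<le> B"
  shows "\<bar>\<integral>y. pois r x y * f y \<partial>sphere_measure\<bar> \<le> B"
proof -
  have "\<bar>\<integral>y. pois r x y * f y \<partial>sphere_measure\<bar> \<le> B + (\<integral>y. 0 \<partial>(sphere_measure :: (real^'n) measure))"
  proof (rule abs_integral_pois_le[OF d x r f])
    fix y :: "real^'n" assume y: "norm y = 1"
    show "\<bar>pois r x y * f y\<bar> \<le> B * pois r x y + 0"
      using mult_left_mono[OF B[OF y] pois_nonneg[OF r, of x y]] pois_nonneg[OF r, of x y]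
      by (simp add: abs_mult mult.commute)
  qed simp
  then show ?thesis by simp
qed

text \<open>The base equals (1 - r)^2 + r |x - y|^2, which is at least \<delta>^2 / 2 once r is at
  least 1/2. Only the factor 1 - r^2 then depends on r.\<close>

lemma pois_le_far:
  fixes x y :: "real^'n"
  assumes "CARD('n) \<ge> 2" "norm x = 1" "norm y = 1" "1 / 2 \<le> r" "r < 1" "0 < \<delta>" "\<delta> \<le> norm (x - y)"
  shows "pois r x y \<le> (1 - r\<^sup>2) * ((\<delta>\<^sup>2 / 2) powr (- (gnu CARD('n) + 1)) / sphere_area CARD('n))"
proof -
  have "(norm (x - y))\<^sup>2 = 2 - 2 * (x \<bullet> y)"
    using assms(2,3) by (simp add: power2_norm_eq_inner inner_diff_left inner_diff_right inner_commute[of y x] norm_eq_1)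
  moreover have "\<delta>\<^sup>2 \<le> (norm (x - y))\<^sup>2" using assms by (intro power_mono) auto
  ultimately have 1: "\<delta>\<^sup>2 \<le> 2 - 2 * (x \<bullet> y)" by simp
  have "\<delta>\<^sup>2 / 2 \<le> r * (2 - 2 * (x \<bullet> y))"
  proof -
    have "(1/2) * \<delta>\<^sup>2 \<le> r * (2 - 2 * (x \<bullet> y))"
      using 1 assms by (intro mult_mono) auto
    then show ?thesis by simp
  qed
  also have "\<dots> \<le> 1 - 2 * r * (x \<bullet> y) + r\<^sup>2"
  proof -
    have "0 \<le> (1 - r)\<^sup>2" by simp
    then show ?thesis by (simp add: power2_eq_square algebra_simps)
  qed
  finally have "(1 - 2 * r * (x \<bullet> y) + r\<^sup>2) powr (- (gnu CARD('n) + 1)) \<le> (\<delta>\<^sup>2 / 2) powr (- (gnu CARD('n) + 1))"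
    using assms gnu_nonneg[OF assms(1)] by (intro powr_mono2') auto
  moreover have "0 \<le> 1 - r\<^sup>2" using assms by (simp add: power_le_one)
  ultimately show ?thesis
    using area_pos[where 'n='n] unfolding pois_def
    by (simp add: divide_right_mono mult_left_mono)
qed

lemma pois_approx_identity:
  fixes f :: "real^'n \<Rightarrow> real"
  assumes d: "CARD('n) \<ge> 2" and x: "norm x = 1" and f: "continuous_on (sphere 0 1) f"
    and r: "\<And>k. 0 \<le> r k" "\<And>k. r k < 1" "r \<longlonglongrightarrow> 1"
  shows "(\<lambda>k. \<integral>y. pois (r k) x y * f y \<partial>sphere_measure) \<longlonglongrightarrow> f x"
proof -
  interpret finite_measure "sphere_measure :: (real^'n) measure" by (rule finite_measure_sphere)
  have fb: "sphere_bm f" by (rule sphere_bm_continuous[OF f])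
  then obtain B where B: "\<And>x. norm x = 1 \<Longrightarrow> \<bar>f x\<bar> \<le> B" by (auto simp: sphere_bm_def)
  have B0: "B \<ge> 0" using B[OF x] by linarith
  have eq: "(\<integral>y. pois (r k) x y * f y \<partial>sphere_measure) - f x = (\<integral>y. pois (r k) x y * (f y - f x) \<partial>sphere_measure)" for k
  proof -
    have p: "sphere_bm (pois (r k) x)" by (intro sphere_bm_continuous continuous_on_pois x r)
    have "integrable sphere_measure (\<lambda>y. pois (r k) x y * f y)" "integrable sphere_measure (\<lambda>y. pois (r k) x y * f x)"
      by (intro sphere_bm_integrable sphere_bm_mult p fb sphere_bm_const)+
    then show ?thesis
      by (simp add: right_diff_distrib integral_pois[OF d x r(1,2)])
  qed
  have "(\<lambda>k. \<integral>y. pois (r k) x y * (f y - f x) \<partial>sphere_measure) \<longlonglongrightarrow> 0"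
  proof (rule LIMSEQ_I)
    fix \<epsilon> :: real assume e: "\<epsilon> > 0"
    obtain \<delta> where \<delta>: "\<delta> > 0" "\<And>y. norm y = 1 \<Longrightarrow> dist y x < \<delta> \<Longrightarrow> dist (f y) (f x) < \<epsilon> / 2"
      using f x e unfolding continuous_on_iff
      by (metis half_gt_zero mem_sphere_0)
    define C where "C = (\<delta>\<^sup>2 / 2) powr (- (gnu CARD('n) + 1)) / sphere_area CARD('n)"
    \<comment> \<open>\<open>C\<close> bounds the singular factor at distance at least \<delta>, and
      \<open>2 * B\<close> bounds the oscillation of f.\<close>
    define g where "g k = (1 - (r k)\<^sup>2) * C * (2 * B)" for k
    have C0: "C \<ge> 0" using area_pos[where 'n='n] by (simp add: C_def)
    have r2: "0 \<le> 1 - (r k)\<^sup>2" for k using r by (simp add: power_le_one less_imp_le)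
    have bound: "\<bar>\<integral>y. pois (r k) x y * (f y - f x) \<partial>sphere_measure\<bar> \<le> \<epsilon> / 2 + (\<integral>y. g k \<partial>(sphere_measure :: (real^'n) measure))"
      if rk: "r k \<ge> 1 / 2" for k
    proof (rule abs_integral_pois_le[OF d x r(1,2)])
      fix y :: "real^'n" assume y: "norm y = 1"
      have p0: "pois (r k) x y \<ge> 0" by (rule pois_nonneg[OF r(1,2)])
      show "\<bar>pois (r k) x y * (f y - f x)\<bar> \<le> \<epsilon> / 2 * pois (r k) x y + g k"
      proof (cases "dist y x < \<delta>")
        case True
        then have "\<bar>f y - f x\<bar> \<le> \<epsilon> / 2" using \<delta>(2)[OF y] by (simp add: dist_real_def)
        then have "\<bar>pois (r k) x y * (f y - f x)\<bar> \<le> pois (r k) x y * (\<epsilon> / 2)"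
          unfolding abs_mult abs_of_nonneg[OF p0] using p0 by (rule mult_left_mono)
        moreover have "g k \<ge> 0" using C0 B0 r2 by (simp add: g_def)
        ultimately show ?thesis by (simp add: mult.commute)
      next
        case False
        then have "pois (r k) x y \<le> (1 - (r k)\<^sup>2) * C"
          unfolding C_def using pois_le_far[OF d x y rk r(2) \<delta>(1)] by (simp add: dist_norm norm_minus_commute)
        moreover have "\<bar>f y - f x\<bar> \<le> 2 * B" using B[OF x] B[OF y] by linarith
        ultimately have "\<bar>pois (r k) x y * (f y - f x)\<bar> \<le> g k"
          unfolding abs_mult g_def using p0 C0 r2[of k] by (intro mult_mono) auto
        moreover have "\<epsilon> / 2 * pois (r k) x y \<ge> 0" using e p0 by simp
        ultimately show ?thesis by linarith
      qed
    qed (use sphere_bmD[OF fb] in auto)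
    have g: "(\<integral>y. g k \<partial>(sphere_measure :: (real^'n) measure)) = sphere_area CARD('n) * g k" for k
      by (simp add: measure_sphere_measure)
    have "(\<lambda>k. (\<integral>y. g k \<partial>(sphere_measure :: (real^'n) measure))) \<longlonglongrightarrow> sphere_area CARD('n) * ((1 - 1\<^sup>2) * C * (2 * B))"
      unfolding g unfolding g_def by (intro tendsto_intros r(3))
    then have "(\<lambda>k. (\<integral>y. g k \<partial>(sphere_measure :: (real^'n) measure))) \<longlonglongrightarrow> 0" by simp
    then have "\<forall>\<^sub>F k in sequentially. (\<integral>y. g k \<partial>(sphere_measure :: (real^'n) measure)) < \<epsilon> / 2"
      by (rule order_tendstoD) (use e in simp)
    moreover have "\<forall>\<^sub>F k in sequentially. r k > 1 / 2"
      using r(3) by (rule order_tendstoD) simp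
    ultimately have "\<forall>\<^sub>F k in sequentially. norm ((\<integral>y. pois (r k) x y * (f y - f x) \<partial>sphere_measure) - 0) < \<epsilon>"
    proof eventually_elim
      case (elim k)
      then show ?case using bound[of k] by simp
    qed
    then show "\<exists>N. \<forall>k\<ge>N. norm ((\<integral>y. pois (r k) x y * (f y - f x) \<partial>sphere_measure) - 0) < \<epsilon>"
      by (simp add: eventually_sequentially)
  qed
  then show ?thesis
    unfolding eq[symmetric] by (rule LIM_zero_cancel)
qed

lemma ex_radii: "\<exists>r::nat \<Rightarrow> real. (\<forall>k. 0 < r k \<and> r k < 1) \<and> r \<longlonglongrightarrow> 1"
proof (intro exI conjI allI)
  \<comment> \<open>The offset 2 starts the radii at 1/2, so all are strictly positive.\<close>
  show "(\<lambda>k. 1 - 1 / real (k + 2)) \<longlonglongrightarrow> 1"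
    using tendsto_diff[OF tendsto_const[of 1] LIMSEQ_ignore_initial_segment[OF lim_1_over_n, of 2]]
    by simp
qed auto

text \<open>Applied to \<open>zker n _ y\<close>, the Poisson means \<open>\<Sum>m. r ^ m * zproj m\<close> reduce by orthogonality to
  the term \<open>m = n\<close>; letting \<open>r \<rightarrow> 1\<close> gives the normalisation without computing any norm.\<close>

lemma zker_idempotent:
  fixes x y :: "real^'n"
  assumes d: "CARD('n) \<ge> 2" and xy: "norm x = 1" "norm y = 1"
  shows "(\<integral>z. zker n x z * zker n z y \<partial>sphere_measure) = zker n x y"
proof -
  obtain r :: "nat \<Rightarrow> real" where r: "\<And>k. 0 < r k" "\<And>k. r k < 1" "r \<longlonglongrightarrow> 1"
    using ex_radii by blast
  let ?f = "\<lambda>z. zker n z y"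
  let ?I = "\<integral>z. zker n x z * zker n z y \<partial>sphere_measure"
  have fc: "continuous_on (sphere 0 1) ?f"
    using continuous_on_zker[OF d, of _ n y] by (simp add: zker_commute[of n _ y])
  have "(\<integral>z. pois (r k) x z * ?f z \<partial>sphere_measure) = r k ^ n * ?I" for k
  proof -
    have "(\<lambda>m. r k ^ m * zproj m ?f x) sums (\<integral>z. pois (r k) x z * ?f z \<partial>sphere_measure)"
      by (intro zproj_sums_pois d sphere_bm_continuous fc xy r less_imp_le[OF r(1)])
    moreover have "r k ^ m * zproj m ?f x = (if m = n then r k ^ m * ?I else 0)" for m
      unfolding zproj_def using zker_orthogonal[OF d xy, of m n] by simp
    moreover have "(\<lambda>m. if m = n then r k ^ m * ?I else 0) sums (r k ^ n * ?I)"
      by (rule sums_single)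
    ultimately show ?thesis using sums_unique2 by fastforce
  qed
  then have "(\<lambda>k. r k ^ n * ?I) \<longlonglongrightarrow> zker n x y"
    using pois_approx_identity[OF d xy(1) fc, of r] r less_imp_le[OF r(1)] by simp
  moreover have "(\<lambda>k. r k ^ n * ?I) \<longlonglongrightarrow> 1 ^ n * ?I"
    by (intro tendsto_intros r(3))
  ultimately show ?thesis using LIMSEQ_unique by fastforce
qed

lemma zproj_zproj:
  fixes f :: "real^'n \<Rightarrow> real"
  assumes d: "CARD('n) \<ge> 2" and f: "sphere_bm f" and x: "norm x = 1"
  shows "zproj n (zproj m f) x = (if n = m then zproj n f x else 0)"
proof -
  note [measurable] = measurable_zker_pair[OF d] sphere_bmD[OF f] sphere_bmD[OF sphere_bm_zker[OF d]]
  obtain B where B: "\<And>x. norm x = 1 \<Longrightarrow> \<bar>f x\<bar> \<le> B" using f by (auto simp: sphere_bm_def)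
  let ?C = "\<lambda>n. zonal_bound (gnu CARD('n)) n / sphere_area CARD('n)"
  have "zproj n (zproj m f) x = (\<integral>z. (\<integral>y. zker n x z * zker m z y * f y \<partial>sphere_measure) \<partial>sphere_measure)"
    unfolding zproj_def by (simp add: mult.assoc)
  also have "\<dots> = (\<integral>y. (\<integral>z. zker n x z * zker m z y * f y \<partial>sphere_measure) \<partial>sphere_measure)"
  proof (rule sphere_Fubini)
    show "(\<lambda>p. zker n x (fst p) * zker m (fst p) (snd p) * f (snd p)) \<in> borel_measurable (sphere_measure \<Otimes>\<^sub>M sphere_measure)"
      by measurable
    fix z y :: "real^'n" assume zy: "norm z = 1" "norm y = 1"
    have 1: "\<bar>zker n x z\<bar> \<le> ?C n" and 2: "\<bar>zker m z y\<bar> \<le> ?C m"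
      using abs_zker_le[OF d x zy(1)] abs_zker_le[OF d zy] by auto
    have 3: "?C n \<ge> 0" "?C m \<ge> 0"
      by (rule order_trans[OF abs_ge_zero 1], rule order_trans[OF abs_ge_zero 2])
    then have "?C n * ?C m \<ge> 0" by (rule mult_nonneg_nonneg)
    then show "\<bar>zker n x z * zker m z y * f y\<bar> \<le> ?C n * ?C m * B"
      unfolding abs_mult using 1 2 3 B[OF zy(2)] by (intro mult_mono) auto
  qed
  also have "\<dots> = (\<integral>y. (if n = m then zker n x y else 0) * f y \<partial>sphere_measure)"
  proof (rule Bochner_Integration.integral_cong[OF refl])
    fix y :: "real^'n" assume "y \<in> space sphere_measure"
    then have y: "norm y = 1" by simp
    show "(\<integral>z. zker n x z * zker m z y * f y \<partial>sphere_measure) = (if n = m then zker n x y else 0) * f y"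
      using zker_idempotent[OF d x y, of n] zker_orthogonal[OF d x y, of n m] by (cases "n = m") simp_all
  qed
  also have "\<dots> = (if n = m then zproj n f x else 0)"
    by (simp add: zproj_def)
  finally show ?thesis .
qed

section \<open>Bessel's identity and completeness\<close>

text \<open>Pythagoras by induction on N. Tested against the N-th projection, the residual gives the
  same value as f, because projections of different degree are orthogonal. Symmetry and idempotence
  make f paired with its projection a squared norm.\<close>

lemma Bessel_zproj:
  fixes f :: "real^'n \<Rightarrow> real"
  assumes d: "CARD('n) \<ge> 2" and f: "sphere_bm f"
  shows "(\<integral>x. (f x - (\<Sum>n<N. zproj n f x))\<^sup>2 \<partial>sphere_measure)
     = (\<integral>x. (f x)\<^sup>2 \<partial>sphere_measure) - (\<Sum>n<N. \<integral>x. f x * zproj n f x \<partial>sphere_measure)"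
    and "(\<integral>x. f x * zproj n f x \<partial>sphere_measure) \<ge> 0"
proof -
  have z: "sphere_bm (zproj n f)" for n by (rule sphere_bm_zproj[OF d f])
  have zz: "(\<integral>x. zproj n f x * zproj m f x \<partial>sphere_measure)
      = (if n = m then \<integral>x. f x * zproj n f x \<partial>sphere_measure else 0)" for n m
  proof -
    have "(\<integral>x. zproj n f x * zproj m f x \<partial>sphere_measure) = (\<integral>x. f x * zproj n (zproj m f) x \<partial>sphere_measure)"
      by (rule zproj_symmetric[OF d f z])
    also have "\<dots> = (\<integral>x. f x * (if n = m then zproj n f x else 0) \<partial>sphere_measure)"
      by (rule Bochner_Integration.integral_cong) (simp_all add: zproj_zproj[OF d f])
    finally show ?thesis by simp
  qed
  show "(\<integral>x. f x * zproj n f x \<partial>sphere_measure) \<ge> 0"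
    using zz[of n n] by (metis (no_types, lifting) integral_nonneg_AE AE_I2 zero_le_square)
  show "(\<integral>x. (f x - (\<Sum>n<N. zproj n f x))\<^sup>2 \<partial>sphere_measure)
     = (\<integral>x. (f x)\<^sup>2 \<partial>sphere_measure) - (\<Sum>n<N. \<integral>x. f x * zproj n f x \<partial>sphere_measure)"
  proof (induction N)
    case (Suc N)
    define g where "g = (\<lambda>x. f x - (\<Sum>n<N. zproj n f x))"
    have gb: "sphere_bm g" unfolding g_def by (intro sphere_bm_diff sphere_bm_sum f z)
    have i: "integrable sphere_measure (\<lambda>x. g x * g x)" "integrable sphere_measure (\<lambda>x. g x * zproj N f x)"
      "integrable sphere_measure (\<lambda>x. zproj N f x * zproj N f x)"
      by (intro sphere_bm_integrable sphere_bm_mult gb z)+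
    have "(\<integral>x. g x * zproj N f x \<partial>sphere_measure)
       = (\<integral>x. f x * zproj N f x - (\<Sum>n<N. zproj n f x * zproj N f x) \<partial>sphere_measure)"
      by (simp add: g_def left_diff_distrib sum_distrib_right)
    also have "\<dots> = (\<integral>x. f x * zproj N f x \<partial>sphere_measure) - (\<Sum>n<N. \<integral>x. zproj n f x * zproj N f x \<partial>sphere_measure)"
      by (subst Bochner_Integration.integral_diff)
         (auto intro!: sphere_bm_integrable sphere_bm_sum sphere_bm_mult f z Bochner_Integration.integral_sum)
    also have "\<dots> = (\<integral>x. f x * zproj N f x \<partial>sphere_measure)"
      unfolding zz by simp
    finally have gz: "(\<integral>x. g x * zproj N f x \<partial>sphere_measure) = (\<integral>x. f x * zproj N f x \<partial>sphere_measure)" .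
    have "(\<integral>x. (f x - (\<Sum>n<Suc N. zproj n f x))\<^sup>2 \<partial>sphere_measure)
       = (\<integral>x. g x * g x - 2 * (g x * zproj N f x) + zproj N f x * zproj N f x \<partial>sphere_measure)"
      by (rule Bochner_Integration.integral_cong) (simp_all add: g_def power2_eq_square algebra_simps)
    also have "\<dots> = (\<integral>x. g x * g x \<partial>sphere_measure) - 2 * (\<integral>x. g x * zproj N f x \<partial>sphere_measure)
         + (\<integral>x. zproj N f x * zproj N f x \<partial>sphere_measure)"
      using i by simp
    also have "\<dots> = (\<integral>x. (g x)\<^sup>2 \<partial>sphere_measure) - (\<integral>x. f x * zproj N f x \<partial>sphere_measure)"
      unfolding gz zz by (simp add: power2_eq_square)
    finally show ?case using Suc.IH unfolding g_def by simp
  qed simp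
qed

text \<open>The Abel sum of the Parseval series is the pairing of f with its Poisson mean, a
  quantity whose limit as r tends to 1 can be found.\<close>

lemma Abel_zproj:
  fixes f :: "real^'n \<Rightarrow> real"
  assumes d: "CARD('n) \<ge> 2" and f: "sphere_bm f" and r: "0 \<le> r" "r < 1"
  shows "(\<lambda>n. r ^ n * (\<integral>x. f x * zproj n f x \<partial>sphere_measure))
     sums (\<integral>x. f x * (\<integral>y. pois r x y * f y \<partial>sphere_measure) \<partial>sphere_measure)"
proof -
  interpret finite_measure "sphere_measure :: (real^'n) measure" by (rule finite_measure_sphere)
  obtain B where B: "\<And>x. norm x = 1 \<Longrightarrow> \<bar>f x\<bar> \<le> B" using f by (auto simp: sphere_bm_def)
  have B0: "B \<ge> 0" using B[of "axis undefined 1"] by simp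
  have z: "sphere_bm (zproj n f)" for n by (rule sphere_bm_zproj[OF d f])
  let ?h = "\<lambda>n x. r ^ n * (f x * zproj n f x)"
  define b where "b n = zonal_bound (gnu CARD('n)) n * r ^ n * (B * B)" for n
  have sb: "summable b"
    unfolding b_def by (intro summable_mult2 summable_zonal_bound gnu_nonneg d r)
  have hb: "norm (?h n x) \<le> b n" if "norm x = 1" for n x
  proof -
    have "norm (?h n x) = r ^ n * (\<bar>f x\<bar> * \<bar>zproj n f x\<bar>)" using r by (simp add: abs_mult)
    also have "\<dots> \<le> r ^ n * (B * (zonal_bound (gnu CARD('n)) n * B))"
      using r zproj_bound[OF d B sphere_bmD[OF f] that, of n] B[OF that] B0
      by (intro mult_left_mono mult_mono) auto
    finally show ?thesis by (simp add: b_def mult_ac)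
  qed
  have hi: "integrable sphere_measure (?h n)" for n
    by (intro integrable_mult_right sphere_bm_integrable sphere_bm_mult f z)
  have "(\<lambda>n. \<integral>x. ?h n x \<partial>sphere_measure) sums (\<integral>x. (\<Sum>n. ?h n x) \<partial>sphere_measure)"
  proof (rule sums_integral[OF hi])
    show "AE y in sphere_measure. summable (\<lambda>n. norm (?h n y))"
      using hb by (intro AE_I2 summable_comparison_test'[OF sb, of 0]) auto
    show "summable (\<lambda>n. \<integral>y. norm (?h n y) \<partial>sphere_measure)"
    proof (rule summable_comparison_test'[OF summable_mult2[OF sb, of "sphere_area CARD('n)"], of 0])
      fix n
      have "(\<integral>y. norm (?h n y) \<partial>sphere_measure) \<le> (\<integral>y. b n \<partial>(sphere_measure :: (real^'n) measure))"
        using hi[of n] hb by (intro integral_mono) auto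
      then show "norm (\<integral>y. norm (?h n y) \<partial>sphere_measure) \<le> b n * sphere_area CARD('n)"
        by (simp add: measure_sphere_measure mult.commute)
    qed
  qed
  moreover have "(\<integral>x. ?h n x \<partial>sphere_measure) = r ^ n * (\<integral>x. f x * zproj n f x \<partial>sphere_measure)" for n
    by simp
  moreover have "(\<integral>x. (\<Sum>n. ?h n x) \<partial>sphere_measure) = (\<integral>x. f x * (\<integral>y. pois r x y * f y \<partial>sphere_measure) \<partial>sphere_measure)"
  proof (rule Bochner_Integration.integral_cong[OF refl])
    fix x :: "real^'n" assume "x \<in> space sphere_measure"
    then have "(\<lambda>n. f x * (r ^ n * zproj n f x)) sums (f x * (\<integral>y. pois r x y * f y \<partial>sphere_measure))"
      by (intro sums_mult zproj_sums_pois d f r) simp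
    then show "(\<Sum>n. ?h n x) = f x * (\<integral>y. pois r x y * f y \<partial>sphere_measure)"
      by (simp add: sums_iff mult.left_commute)
  qed
  ultimately show ?thesis by (simp only:)
qed

text \<open>Bessel bounds the sum of the Parseval terms \<open>a n\<close> by \<open>F\<close>.
  Conversely, since these terms are nonnegative, every Abel sum is at most their ordinary sum, while
  the Abel sums tend to \<open>F\<close>.\<close>

lemma zproj_complete:
  fixes f :: "real^'n \<Rightarrow> real"
  assumes d: "CARD('n) \<ge> 2" and fc: "continuous_on (sphere 0 1) f"
  shows "(\<lambda>N. \<integral>x. (f x - (\<Sum>n<N. zproj n f x))\<^sup>2 \<partial>sphere_measure) \<longlonglongrightarrow> 0"
proof -
  have f: "sphere_bm f" by (rule sphere_bm_continuous[OF fc])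
  obtain B where B: "\<And>x. norm x = 1 \<Longrightarrow> \<bar>f x\<bar> \<le> B" using f by (auto simp: sphere_bm_def)
  obtain r :: "nat \<Rightarrow> real" where r: "\<And>k. 0 < r k" "\<And>k. r k < 1" "r \<longlonglongrightarrow> 1"
    using ex_radii by blast
  define a where "a n = (\<integral>x. f x * zproj n f x \<partial>sphere_measure)" for n
  define F where "F = (\<integral>x. (f x)\<^sup>2 \<partial>sphere_measure)"
  have a0: "a n \<ge> 0" for n unfolding a_def by (rule Bessel_zproj(2)[OF d f])
  have E: "(\<integral>x. (f x - (\<Sum>n<N. zproj n f x))\<^sup>2 \<partial>sphere_measure) = F - sum a {..<N}" for N
    unfolding a_def F_def by (rule Bessel_zproj(1)[OF d f])
  have "0 \<le> F - sum a {..<N}" for N unfolding E[symmetric] by simp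
  then have aF: "sum a {..<N} \<le> F" for N by (simp add: field_simps)
  have sa: "summable a" by (rule summableI_nonneg_bounded[OF a0 aF])
  have SF: "suminf a \<le> F" by (rule suminf_le_const[OF sa aF])
  define P where "P k x = (\<integral>y. pois (r k) x y * f y \<partial>sphere_measure)" for k x
  have S: "(\<lambda>n. r k ^ n * a n) sums (\<integral>x. f x * P k x \<partial>sphere_measure)" for k
    unfolding a_def P_def by (rule Abel_zproj[OF d f less_imp_le[OF r(1)] r(2)])
  have "(\<integral>x. f x * P k x \<partial>sphere_measure) \<le> suminf a" for k
  proof (rule sums_le[OF _ S summable_sums[OF sa]])
    fix n
    show "r k ^ n * a n \<le> a n"
      using r(1,2)[of k] a0[of n] by (intro mult_left_le_one_le) (auto intro: power_le_one less_imp_le)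
  qed
  moreover have "(\<lambda>k. \<integral>x. f x * P k x \<partial>sphere_measure) \<longlonglongrightarrow> (\<integral>x. f x * f x \<partial>sphere_measure)"
  proof (rule integral_dominated_convergence)
    interpret finite_measure "sphere_measure :: (real^'n) measure" by (rule finite_measure_sphere)
    show "integrable (sphere_measure :: (real^'n) measure) (\<lambda>_. B * B)" by simp
    note [measurable] = sphere_bmD[OF f]
    show "(\<lambda>x. f x * f x) \<in> borel_measurable sphere_measure" by measurable
    show "(\<lambda>x. f x * P k x) \<in> borel_measurable sphere_measure" for k
    proof -
      \<comment> \<open>Measurability of the Poisson mean in x is obtained from its pointwise
        expansion into measurable projections.\<close>
      have "(\<lambda>x. \<Sum>n. r k ^ n * zproj n f x) \<in> borel_measurable sphere_measure"
        using sphere_bmD[OF sphere_bm_zproj[OF d f]] by measurable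
      also have "?this \<longleftrightarrow> P k \<in> borel_measurable sphere_measure"
      proof (rule measurable_cong)
        fix x :: "real^'n" assume "x \<in> space sphere_measure"
        then show "(\<Sum>n. r k ^ n * zproj n f x) = P k x"
          using zproj_sums_pois[OF d f _ less_imp_le[OF r(1)] r(2)] by (simp add: P_def sums_iff)
      qed
      finally show ?thesis by measurable
    qed
    show "AE x in sphere_measure. (\<lambda>k. f x * P k x) \<longlonglongrightarrow> f x * f x"
    proof (rule AE_I2)
      fix x :: "real^'n" assume "x \<in> space sphere_measure"
      then show "(\<lambda>k. f x * P k x) \<longlonglongrightarrow> f x * f x"
        unfolding P_def
        by (intro tendsto_intros pois_approx_identity[OF d _ fc] r less_imp_le[OF r(1)]) simp
    qed
    show "AE x in sphere_measure. norm (f x * P k x) \<le> B * B" for k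
    proof (rule AE_I2)
      fix x :: "real^'n" assume "x \<in> space sphere_measure"
      then have x: "norm x = 1" by simp
      have "\<bar>P k x\<bar> \<le> B"
        unfolding P_def
        by (rule abs_integral_pois_bounded[OF d x less_imp_le[OF r(1)] r(2) sphere_bmD[OF f] B])
      then show "norm (f x * P k x) \<le> B * B"
        unfolding real_norm_def abs_mult using B[OF x] by (intro mult_mono) auto
    qed
  qed
  ultimately have "F \<le> suminf a"
    unfolding F_def power2_eq_square by (intro LIMSEQ_le_const2) auto
  with SF have "suminf a = F" by simp
  then have "(\<lambda>N. sum a {..<N}) \<longlonglongrightarrow> F" using summable_LIMSEQ[OF sa] by simp
  then have "(\<lambda>N. F - sum a {..<N}) \<longlonglongrightarrow> F - F" by (intro tendsto_intros)
  then show ?thesis unfolding E by simp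
qed

section \<open>Hemispherical integrals and the random model\<close>

definition hemi_integral :: "(real^'n \<Rightarrow> real) \<Rightarrow> real^'n \<Rightarrow> real" where
  "hemi_integral f z = (\<integral>b. (if z \<bullet> b \<ge> 0 then f b else 0) \<partial>sphere_measure)"

lemma measurable_halfspace_if:
  fixes f :: "real^'n \<Rightarrow> real"
  assumes "f \<in> borel_measurable sphere_measure"
  shows "(\<lambda>b. if z \<bullet> b \<ge> 0 then f b else 0) \<in> borel_measurable sphere_measure"
proof -
  have [measurable]: "(\<lambda>b. z \<bullet> b) \<in> borel_measurable sphere_measure"
    by (intro measurable_sphere_borel) simp
  note [measurable] = assms
  show ?thesis by measurable
qed

lemma integrable_halfspace_if:
  fixes f :: "real^'n \<Rightarrow> real"
  assumes "integrable sphere_measure f"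
  shows "integrable sphere_measure (\<lambda>b. if z \<bullet> b \<ge> 0 then f b else 0)"
  by (rule Bochner_Integration.integrable_bound[OF assms measurable_halfspace_if]) (use assms in auto)

text \<open>As x n tends to a, the half-space indicators converge at every b not orthogonal to a.
  The exceptional b form a null great sphere, and |f| dominates.\<close>

lemma continuous_on_hemi_integral:
  fixes f :: "real^'n \<Rightarrow> real"
  assumes f: "integrable sphere_measure f"
  shows "continuous_on (sphere 0 1) (hemi_integral f)"
  unfolding continuous_on_sequentially o_def
proof (intro allI ballI impI, elim conjE)
  fix x :: "nat \<Rightarrow> real^'n" and a
  assume a: "a \<in> sphere 0 1" and x: "x \<longlonglongrightarrow> a"
  show "(\<lambda>n. hemi_integral f (x n)) \<longlonglongrightarrow> hemi_integral f a"
    unfolding hemi_integral_def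
  proof (rule integral_dominated_convergence[where w = "\<lambda>b. \<bar>f b\<bar>"])
    have "a \<noteq> 0" using a by auto
    then show "AE b in sphere_measure. (\<lambda>n. if x n \<bullet> b \<ge> 0 then f b else 0) \<longlonglongrightarrow> (if a \<bullet> b \<ge> 0 then f b else 0)"
    proof (rule AE_mp[OF AE_sphere_inner_nonzero AE_I2], intro impI)
      fix b assume ab: "a \<bullet> b \<noteq> 0"
      have lim: "(\<lambda>n. x n \<bullet> b) \<longlonglongrightarrow> a \<bullet> b" by (intro tendsto_intros x)
      have "\<forall>\<^sub>F n in sequentially. (if x n \<bullet> b \<ge> 0 then f b else 0) = (if a \<bullet> b \<ge> 0 then f b else 0)"
      proof (cases "a \<bullet> b > 0")
        case True
        from order_tendstoD(1)[OF lim this] show ?thesis by eventually_elim (use True in auto)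
      next
        case False
        then have n: "a \<bullet> b < 0" using ab by simp
        from order_tendstoD(2)[OF lim this] show ?thesis by eventually_elim (use n in auto)
      qed
      then show "(\<lambda>n. if x n \<bullet> b \<ge> 0 then f b else 0) \<longlonglongrightarrow> (if a \<bullet> b \<ge> 0 then f b else 0)"
        by (rule tendsto_eventually)
    qed
  qed (use f in \<open>auto intro!: measurable_halfspace_if\<close>)
qed

text \<open>Opposite closed hemispheres cover the sphere and overlap only in a null great
  sphere.\<close>

lemma hemi_integral_uminus:
  fixes f :: "real^'n \<Rightarrow> real"
  assumes f: "integrable sphere_measure f" and "z \<noteq> 0"
  shows "hemi_integral f (- z) = (\<integral>b. f b \<partial>sphere_measure) - hemi_integral f z"
proof -
  have "hemi_integral f (- z) + hemi_integral f z
     = (\<integral>b. (if - z \<bullet> b \<ge> 0 then f b else 0) + (if z \<bullet> b \<ge> 0 then f b else 0) \<partial>sphere_measure)"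
    unfolding hemi_integral_def by (intro Bochner_Integration.integral_add[symmetric] integrable_halfspace_if f)
  also have "\<dots> = (\<integral>b. f b \<partial>sphere_measure)"
  proof (rule integral_cong_AE)
    show "AE b in sphere_measure. (if - z \<bullet> b \<ge> 0 then f b else 0) + (if z \<bullet> b \<ge> 0 then f b else 0) = f b"
      by (rule AE_mp[OF AE_sphere_inner_nonzero[OF assms(2)] AE_I2]) auto
    show "(\<lambda>b. (if - z \<bullet> b \<ge> 0 then f b else 0) + (if z \<bullet> b \<ge> 0 then f b else 0)) \<in> borel_measurable sphere_measure"
      by (intro borel_measurable_add measurable_halfspace_if) (use f in auto)
  qed (use f in simp)
  finally show ?thesis by simp
qed

lemma integral_even_hemi:
  fixes \<phi> :: "real^'n \<Rightarrow> real"
  assumes \<phi>: "integrable sphere_measure \<phi>" and even: "\<And>z. norm z = 1 \<Longrightarrow> \<phi> (- z) = \<phi> z"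
  shows "2 * (\<integral>z. indicator (hemi e) z * \<phi> z \<partial>sphere_measure) = (\<integral>z. \<phi> z \<partial>sphere_measure)"
proof -
  have ax: "axis e 1 \<bullet> z = z $ e" for z :: "real^'n" by (simp add: inner_axis inner_commute)
  have cong: "(\<integral>z. indicator (hemi e) z * \<phi> z \<partial>sphere_measure) = hemi_integral \<phi> z0" if "z0 = axis e 1" for z0
    unfolding hemi_integral_def that ax
    by (rule Bochner_Integration.integral_cong) (auto simp: hemi_def)
  have "hemi_integral \<phi> (- axis e 1) = (\<integral>b. (if axis e 1 \<bullet> (- b) \<ge> 0 then \<phi> (- b) else 0) \<partial>sphere_measure)"
    unfolding hemi_integral_def by (rule Bochner_Integration.integral_cong) (auto simp: even)
  also have "\<dots> = hemi_integral \<phi> (axis e 1)"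
    unfolding hemi_integral_def
    by (rule integral_sphere_orthogonal[OF orthogonal_transformation_uminus])
       (use \<phi> in \<open>auto intro!: measurable_halfspace_if\<close>)
  finally show ?thesis
    using hemi_integral_uminus[OF \<phi>, of "axis e 1"] cong[OF refl] by (simp add: axis_eq_0_iff)
qed

section \<open>Parity of the projections\<close>

lemma zker_uminus:
  fixes x y :: "real^'n"
  assumes "CARD('n) \<ge> 2"
  shows "zker n x (- y) = (-1) ^ n * zker n x y"
  using zonal_minus[OF gnu_nonneg[OF assms]] by (simp add: zker_def)

text \<open>Serves for both parities: it removes the even degrees of an odd function and the odd
  degrees of a constant.\<close>

lemma zproj_parity:
  fixes f :: "real^'n \<Rightarrow> real"
  assumes d: "CARD('n) \<ge> 2" and f: "f \<in> borel_measurable sphere_measure"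
    and odd: "\<And>y. norm y = 1 \<Longrightarrow> (-1) ^ n * f (- y) = - f y"
  shows "zproj n f x = 0"
proof -
  have "zproj n f x = (\<integral>y. zker n x (- y) * f (- y) \<partial>sphere_measure)"
    unfolding zproj_def
    by (rule integral_sphere_orthogonal[OF orthogonal_transformation_uminus, symmetric])
       (intro borel_measurable_times f sphere_bmD sphere_bm_zker d)
  also have "\<dots> = (\<integral>y. - (zker n x y * f y) \<partial>sphere_measure)"
  proof (rule Bochner_Integration.integral_cong[OF refl])
    fix y :: "real^'n" assume "y \<in> space sphere_measure"
    then have "(-1) ^ n * f (- y) = - f y" by (intro odd) simp
    then show "zker n x (- y) * f (- y) = - (zker n x y * f y)"
      unfolding zker_uminus[OF d] by (metis mult.assoc mult.commute mult_minus_right)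
  qed
  also have "\<dots> = - zproj n f x" by (simp add: zproj_def)
  finally show ?thesis by simp
qed

lemma qker_eq_zker:
  fixes x y :: "real^'n"
  assumes "CARD('n) \<ge> 2" "norm x = 1" "norm y = 1"
  shows "qker n CARD('n) x y = zker n x y"
  unfolding zker_def by (rule qker_eq_zonal[OF assms])

lemma Qproj_eq_zproj:
  fixes f :: "real^'n \<Rightarrow> real"
  assumes "CARD('n) \<ge> 2" "norm x = 1"
  shows "Qproj n f x = zproj n f x"
  unfolding Qproj_def zproj_def
  by (rule Bochner_Integration.integral_cong) (simp_all add: qker_eq_zker assms)

lemma zproj_cong_AE:
  fixes f g :: "real^'n \<Rightarrow> real"
  assumes "CARD('n) \<ge> 2" "AE y in sphere_measure. f y = g y"
    "f \<in> borel_measurable sphere_measure" "g \<in> borel_measurable sphere_measure"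
  shows "zproj n f x = zproj n g x"
  unfolding zproj_def
  by (rule integral_cong_AE) (use assms in \<open>auto intro!: borel_measurable_times sphere_bmD[OF sphere_bm_zker]\<close>)

section \<open>The joint law and the conditional probability\<close>

text \<open>The joint density is the product of the two densities. The variable of \<beta> is
  integrated first so that \<open>hemi_integral\<close> appears as the inner integral.\<close>

lemma (in prob_space) expectation_indep_sphere:
  fixes \<beta> X :: "'a \<Rightarrow> real^'n" and f\<beta> fX :: "real^'n \<Rightarrow> real" and g :: "real^'n \<Rightarrow> real^'n \<Rightarrow> real"
  assumes indep: "indep_var sphere_measure \<beta> sphere_measure X"
    and f\<beta>: "\<And>b. f\<beta> b \<ge> 0" "distributed M sphere_measure \<beta> (\<lambda>b. ennreal (f\<beta> b))"
    and fX: "\<And>x. fX x \<ge> 0" "distributed M sphere_measure X (\<lambda>x. ennreal (fX x))"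
    and g: "(\<lambda>p. g (fst p) (snd p)) \<in> borel_measurable (sphere_measure \<Otimes>\<^sub>M sphere_measure)"
    and int: "integrable (sphere_measure \<Otimes>\<^sub>M sphere_measure) (\<lambda>p. f\<beta> (fst p) * fX (snd p) * g (fst p) (snd p))"
  shows "expectation (\<lambda>\<omega>. g (\<beta> \<omega>) (X \<omega>))
    = (\<integral>z. (\<integral>b. f\<beta> b * fX z * g b z \<partial>sphere_measure) \<partial>sphere_measure)"
proof -
  interpret S: finite_measure "sphere_measure :: (real^'n) measure" by (rule finite_measure_sphere)
  interpret P: pair_sigma_finite "sphere_measure :: (real^'n) measure" "sphere_measure :: (real^'n) measure" ..
  have "distributed M (sphere_measure \<Otimes>\<^sub>M sphere_measure) (\<lambda>\<omega>. (\<beta> \<omega>, X \<omega>))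
      (\<lambda>(b, z). ennreal (f\<beta> b) * ennreal (fX z))"
    by (rule distributed_joint_indep[OF S.sigma_finite_measure_axioms S.sigma_finite_measure_axioms f\<beta>(2) fX(2) indep])
  also have "(\<lambda>(b, z). ennreal (f\<beta> b) * ennreal (fX z)) = (\<lambda>p. ennreal (f\<beta> (fst p) * fX (snd p)))"
    using f\<beta>(1) fX(1) by (auto simp: ennreal_mult)
  finally have D: "distributed M (sphere_measure \<Otimes>\<^sub>M sphere_measure) (\<lambda>\<omega>. (\<beta> \<omega>, X \<omega>))
      (\<lambda>p. ennreal (f\<beta> (fst p) * fX (snd p)))" .
  have "expectation (\<lambda>\<omega>. g (\<beta> \<omega>) (X \<omega>))
     = (\<integral>p. f\<beta> (fst p) * fX (snd p) * g (fst p) (snd p) \<partial>(sphere_measure \<Otimes>\<^sub>M sphere_measure))"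
    using distributed_integral[OF D g] f\<beta>(1) fX(1) by simp
  also have "\<dots> = (\<integral>z. (\<integral>b. f\<beta> b * fX z * g b z \<partial>sphere_measure) \<partial>sphere_measure)"
    using P.integral_snd[of "\<lambda>b z. f\<beta> b * fX z * g b z"] int by (simp add: case_prod_beta')
  finally show ?thesis .
qed

lemma sphere_integrable_prod:
  fixes u v :: "real^'n \<Rightarrow> real"
  assumes u: "integrable sphere_measure u" and v: "integrable sphere_measure v"
  shows "integrable (sphere_measure \<Otimes>\<^sub>M sphere_measure) (\<lambda>p. u (fst p) * v (snd p))"
proof -
  interpret S: finite_measure "sphere_measure :: (real^'n) measure" by (rule finite_measure_sphere)
  interpret P: pair_sigma_finite "sphere_measure :: (real^'n) measure" "sphere_measure :: (real^'n) measure" ..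
  note [measurable] = borel_measurable_integrable[OF u] borel_measurable_integrable[OF v]
  show ?thesis
  proof (rule P.Fubini_integrable)
    show "(\<lambda>p. u (fst p) * v (snd p)) \<in> borel_measurable (sphere_measure \<Otimes>\<^sub>M sphere_measure)" by measurable
    show "integrable sphere_measure (\<lambda>x. \<integral>y. norm (u (fst (x, y)) * v (snd (x, y))) \<partial>sphere_measure)"
      using u by (simp add: abs_mult)
    show "AE x in sphere_measure. integrable sphere_measure (\<lambda>y. u (fst (x, y)) * v (snd (x, y)))"
      using v by simp
  qed
qed

lemma measurable_sphere_id: "(\<lambda>x. x) \<in> (sphere_measure :: (real^'n) measure) \<rightarrow>\<^sub>M borel"
  by (rule measurable_sphere_borel) simp

lemma measurable_inner_sphere_pair:
  "(\<lambda>p. snd p \<bullet> fst p) \<in> borel_measurable ((sphere_measure :: (real^'n) measure) \<Otimes>\<^sub>M sphere_measure)"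
  by (intro borel_measurable_inner measurable_compose[OF measurable_fst measurable_sphere_id]
      measurable_compose[OF measurable_snd measurable_sphere_id])

lemma hemi_measurable: "hemi e \<in> sets (sphere_measure :: (real^'n) measure)"
proof -
  have "{x :: real^'n. x $ e \<ge> 0} \<in> sets borel" by measurable
  moreover have "hemi e = sphere 0 1 \<inter> {x :: real^'n. x $ e \<ge> 0}" by (auto simp: hemi_def)
  ultimately show ?thesis by (auto simp: sets_sphere_measure sets_restrict_space)
qed

text \<open>Independence allows \<beta> to be integrated out with X held fixed. The claim is
  verified through the defining property of conditional expectation: every event generated by X is
  the preimage of a set \<open>C\<close>, so testing on it means inserting
  \<open>indicator C\<close>.\<close>

lemma (in prob_space) cond_prob_hemi_integral:
  fixes \<beta> X :: "'a \<Rightarrow> real^'n" and f\<beta> fX :: "real^'n \<Rightarrow> real"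
  assumes indep: "indep_var sphere_measure \<beta> sphere_measure X"
    and f\<beta>: "\<And>b. f\<beta> b \<ge> 0" "distributed M sphere_measure \<beta> (\<lambda>b. ennreal (f\<beta> b))"
    and fX: "\<And>x. fX x \<ge> 0" "distributed M sphere_measure X (\<lambda>x. ennreal (fX x))"
    and i\<beta>: "integrable sphere_measure f\<beta>" and iX: "integrable sphere_measure fX"
  shows "AE \<omega> in M. real_cond_exp M (vimage_algebra (space M) X sphere_measure)
          (\<lambda>\<omega>. if X \<omega> \<bullet> \<beta> \<omega> \<ge> 0 then 1 else 0) \<omega> = hemi_integral f\<beta> (X \<omega>)"
proof -
  let ?F = "vimage_algebra (space M) X sphere_measure"
  have Xm [measurable]: "X \<in> M \<rightarrow>\<^sub>M sphere_measure" by (rule distributed_measurable[OF fX(2)])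
  have bm [measurable]: "\<beta> \<in> M \<rightarrow>\<^sub>M sphere_measure" by (rule distributed_measurable[OF f\<beta>(2)])
  have Xs: "X \<in> space M \<rightarrow> space sphere_measure" using measurable_space[OF Xm] by auto
  have Ym: "(\<lambda>\<omega>. X \<omega> \<bullet> \<beta> \<omega>) \<in> borel_measurable M"
    using measurable_compose[OF Xm measurable_sphere_id] measurable_compose[OF bm measurable_sphere_id]
    by (rule borel_measurable_inner)
  have Hb: "sphere_bm (hemi_integral f\<beta>)"
    by (intro sphere_bm_continuous continuous_on_hemi_integral i\<beta>)
  then obtain B where B: "\<And>x. norm x = 1 \<Longrightarrow> \<bar>hemi_integral f\<beta> x\<bar> \<le> B" by (auto simp: sphere_bm_def)
  note Hm [measurable] = sphere_bmD[OF Hb]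
  interpret F: finite_measure_subalgebra M ?F
  proof
    show "subalgebra M ?F"
      unfolding subalgebra_def sets_vimage_algebra2[OF Xs] by (auto intro: measurable_sets)
  qed
  show ?thesis
  proof (rule F.real_cond_exp_charact)
    show "integrable M (\<lambda>\<omega>. if X \<omega> \<bullet> \<beta> \<omega> \<ge> 0 then 1 else 0 :: real)"
      using Ym by (intro integrable_const_bound[of _ 1]) auto
    show "integrable M (\<lambda>\<omega>. hemi_integral f\<beta> (X \<omega>))"
      using Xs by (intro integrable_const_bound[of _ B] AE_I2) (auto intro!: B simp: Pi_iff)
    show "(\<lambda>\<omega>. hemi_integral f\<beta> (X \<omega>)) \<in> borel_measurable ?F"
      by (rule measurable_compose[OF measurable_vimage_algebra1[OF Xs] Hm])
    fix A assume "A \<in> sets ?F"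
    then obtain C where C [measurable]: "C \<in> sets sphere_measure" and A: "A = X -` C \<inter> space M"
      unfolding sets_vimage_algebra2[OF Xs] by auto
    let ?g = "\<lambda>b z. indicator C z * (if z \<bullet> b \<ge> 0 then 1 else 0) :: real"
    note [measurable] = measurable_inner_sphere_pair
    have g: "(\<lambda>p. ?g (fst p) (snd p)) \<in> borel_measurable (sphere_measure \<Otimes>\<^sub>M sphere_measure)"
      by measurable
    have "(\<integral>\<omega>\<in>A. (if X \<omega> \<bullet> \<beta> \<omega> \<ge> 0 then 1 else 0) \<partial>M) = expectation (\<lambda>\<omega>. ?g (\<beta> \<omega>) (X \<omega>))"
      unfolding set_lebesgue_integral_def
      by (rule Bochner_Integration.integral_cong) (auto simp: A indicator_def)
    also have "\<dots> = (\<integral>z. (\<integral>b. f\<beta> b * fX z * ?g b z \<partial>sphere_measure) \<partial>sphere_measure)"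
    proof (rule expectation_indep_sphere[OF indep f\<beta> fX g])
      show "integrable (sphere_measure \<Otimes>\<^sub>M sphere_measure) (\<lambda>p. f\<beta> (fst p) * fX (snd p) * ?g (fst p) (snd p))"
        by (rule Bochner_Integration.integrable_bound[OF sphere_integrable_prod[OF i\<beta> iX]])
           (use g borel_measurable_integrable[OF sphere_integrable_prod[OF i\<beta> iX]]
            in \<open>auto simp: abs_mult f\<beta>(1) fX(1) indicator_def intro!: borel_measurable_times\<close>)
    qed
    also have "\<dots> = (\<integral>z. fX z * (indicator C z * hemi_integral f\<beta> z) \<partial>sphere_measure)"
    proof (rule Bochner_Integration.integral_cong[OF refl])
      fix z :: "real^'n"
      have "f\<beta> b * fX z * ?g b z = fX z * indicator C z * (if z \<bullet> b \<ge> 0 then f\<beta> b else 0)" for b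
        by simp
      then show "(\<integral>b. f\<beta> b * fX z * ?g b z \<partial>sphere_measure) = fX z * (indicator C z * hemi_integral f\<beta> z)"
        by (simp only: hemi_integral_def integral_mult_right_zero mult.assoc)
    qed
    also have "\<dots> = expectation (\<lambda>\<omega>. indicator C (X \<omega>) * hemi_integral f\<beta> (X \<omega>))"
      by (rule distributed_integral[OF fX(2)]) (measurable, rule fX(1))
    also have "\<dots> = (\<integral>\<omega>\<in>A. hemi_integral f\<beta> (X \<omega>) \<partial>M)"
      unfolding set_lebesgue_integral_def
      by (rule Bochner_Integration.integral_cong) (auto simp: A indicator_def)
    finally show "(\<integral>\<omega>\<in>A. (if X \<omega> \<bullet> \<beta> \<omega> \<ge> 0 then 1 else 0) \<partial>M) = (\<integral>\<omega>\<in>A. hemi_integral f\<beta> (X \<omega>) \<partial>M)" .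
  qed
qed

lemma distributed_sphere_density:
  fixes X :: "'a \<Rightarrow> real^'n" and fX :: "real^'n \<Rightarrow> real"
  assumes "prob_space M" and fX: "\<And>x. fX x \<ge> 0" "distributed M sphere_measure X (\<lambda>x. ennreal (fX x))"
  shows "integrable sphere_measure fX" "(\<integral>x. fX x \<partial>sphere_measure) = 1"
proof -
  interpret prob_space M by fact
  show "integrable sphere_measure fX"
    using distributed_integrable[OF fX(2), of "\<lambda>_. 1"] fX(1) by simp
  show "(\<integral>x. fX x \<partial>sphere_measure) = 1"
    using distributed_integral[OF fX(2), of "\<lambda>_. 1"] fX(1) by (simp add: prob_space)
qed

theorem theorem4p1:
  fixes M :: "'a measure"
    and \<beta> X :: "'a \<Rightarrow> real^'n"
    and f\<beta> fX r :: "real^'n \<Rightarrow> real"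
    and e :: 'n
  assumes d2: "CARD('n) \<ge> 2"
    and P: "prob_space M"
    and indep: "prob_space.indep_var M sphere_measure \<beta> sphere_measure X"
    and f\<beta>_nonneg: "\<And>b. f\<beta> b \<ge> 0"
    and f\<beta>_dist: "distributed M sphere_measure \<beta> (\<lambda>b. ennreal (f\<beta> b))"
    and f\<beta>_L2: "(\<integral>\<^sup>+ b. ennreal ((f\<beta> b)\<^sup>2) \<partial>sphere_measure) < \<infinity>"
    and fX_nonneg: "\<And>x. fX x \<ge> 0"
    and fX_dist: "distributed M sphere_measure X (\<lambda>x. ennreal (fX x))"
    and fX_pos: "AE x in sphere_measure. x \<in> hemi e \<longrightarrow> fX x > 0"
    and fX_zero: "\<And>x. x \<notin> hemi e \<Longrightarrow> fX x = 0"
    and r_meas: "r \<in> borel_measurable sphere_measure"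
    and r_cond: "AE \<omega> in M. r (X \<omega>) =
        real_cond_exp M (vimage_algebra (space M) X sphere_measure)
          (\<lambda>\<omega>. if X \<omega> \<bullet> \<beta> \<omega> \<ge> 0 then 1 else 0) \<omega>"
  defines "R \<equiv> (\<lambda>x. if x $ e \<ge> 0 then r x else 1 - r (- x))"
    and "T \<equiv> (\<lambda>p x. prob_space.expectation M
                (\<lambda>\<omega>. (2 * (if X \<omega> \<bullet> \<beta> \<omega> \<ge> 0 then 1 else 0) - 1) / fX (X \<omega>) * qker (2*p+1) CARD('n) (X \<omega>) x))"
  shows "(\<forall>p. \<forall>x \<in> sphere 0 1. T p x = Qproj (2*p+1) R x)
       \<and> (\<lambda>N. \<integral>\<^sup>+ x. ennreal ((1/2 + (\<Sum>p<N. T p x) - R x)\<^sup>2) \<partial>sphere_measure)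
           \<longlonglongrightarrow> 0"
proof -
  interpret prob_space M by (rule P)
  interpret S: finite_measure "sphere_measure :: (real^'n) measure" by (rule finite_measure_sphere)
  note i\<beta> = distributed_sphere_density[OF P f\<beta>_nonneg f\<beta>_dist]
  note iX = distributed_sphere_density[OF P fX_nonneg fX_dist]
  have Xm [measurable]: "X \<in> M \<rightarrow>\<^sub>M sphere_measure" by (rule distributed_measurable[OF fX_dist])
  have [measurable]: "fX \<in> borel_measurable sphere_measure" "f\<beta> \<in> borel_measurable sphere_measure"
    using iX i\<beta> by auto
  note [measurable] = r_meas hemi_measurable
  define H where "H = hemi_integral f\<beta>"
  \<comment> \<open>Centring at 1/2 makes the function odd, so all its even components vanish, the
    constant one included.\<close>
  define f where "f = (\<lambda>z. H z - 1 / 2)"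
  have Hc: "continuous_on (sphere 0 1) H"
    unfolding H_def by (rule continuous_on_hemi_integral[OF i\<beta>(1)])
  have fc: "continuous_on (sphere 0 1) f"
    unfolding f_def by (intro continuous_intros Hc)
  note Hm [measurable] = measurable_sphere_continuous[OF Hc]
  note fm [measurable] = measurable_sphere_continuous[OF fc]
  have fb: "sphere_bm f" by (rule sphere_bm_continuous[OF fc])
  have H_minus: "H (- z) = 1 - H z" if "norm z = 1" for z
    using hemi_integral_uminus[OF i\<beta>(1), of z] that i\<beta>(2) unfolding H_def by force
  have f_minus: "f (- z) = - f z" if "norm z = 1" for z
    using H_minus[OF that] by (simp add: f_def)

  have "AE \<omega> in M. r (X \<omega>) = H (X \<omega>)"
    using r_cond cond_prob_hemi_integral[OF indep f\<beta>_nonneg f\<beta>_dist fX_nonneg fX_dist i\<beta>(1) iX(1)]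
    unfolding H_def by eventually_elim simp
  \<comment> \<open>The version \<open>r\<close> is pinned down only almost surely under the law of
    X. Positivity of the density transfers this to almost every point of the hemisphere; reflection,
    which preserves null sets, then covers the rest.\<close>
  then have "AE z in distr M sphere_measure X. r z = H z"
    by (subst AE_distr_iff[OF Xm]) measurable
  then have "AE z in sphere_measure. ennreal (fX z) > 0 \<longrightarrow> r z = H z"
    unfolding distributed_distr_eq_density[OF fX_dist] by (subst (asm) AE_density) measurable
  with fX_pos have rH: "AE z in sphere_measure. z \<in> hemi e \<longrightarrow> r z = H z"
    by eventually_elim (auto simp: ennreal_less_zero_iff)
  have RH: "AE z in sphere_measure. R z = H z"
    using rH AE_sphere_uminus[OF rH]
  proof (rule AE_mp[OF _ AE_mp[OF _ AE_I2]], intro impI)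
    fix z :: "real^'n"
    assume z: "z \<in> space sphere_measure" and 1: "z \<in> hemi e \<longrightarrow> r z = H z" and 2: "- z \<in> hemi e \<longrightarrow> r (- z) = H (- z)"
    have "norm z = 1" using z by simp
    with 1 2 H_minus[of z] show "R z = H z" by (auto simp: R_def hemi_def)
  qed
  have um [measurable]: "uminus \<in> (sphere_measure :: (real^'n) measure) \<rightarrow>\<^sub>M sphere_measure"
    by (rule measurable_sphere_orthogonal[OF orthogonal_transformation_uminus])
  have [measurable]: "(\<lambda>z. z $ e) \<in> borel_measurable (sphere_measure :: (real^'n) measure)"
    by (rule measurable_sphere_borel) simp
  have Rm: "R \<in> borel_measurable sphere_measure" unfolding R_def by measurable

  have QR: "Qproj (2 * p + 1) R x = zproj (2 * p + 1) f x" if x: "norm x = 1" for p x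
  proof -
    let ?n = "2 * p + 1"
    have "Qproj ?n R x = zproj ?n H x"
      unfolding Qproj_eq_zproj[OF d2 x] by (rule zproj_cong_AE[OF d2 RH Rm Hm])
    also have "\<dots> = (\<integral>y. zker ?n x y * f y + zker ?n x y * (1 / 2) \<partial>sphere_measure)"
      unfolding zproj_def f_def by (simp add: algebra_simps)
    also have "\<dots> = zproj ?n f x + zproj ?n (\<lambda>_. 1 / 2) x"
      unfolding zproj_def
      by (intro Bochner_Integration.integral_add sphere_bm_integrable sphere_bm_mult sphere_bm_zker d2 fb sphere_bm_const)
    also have "zproj ?n (\<lambda>_. 1 / 2) x = 0"
      by (rule zproj_parity[OF d2]) auto
    finally show ?thesis by simp
  qed

  have TQ: "T p x = zproj (2 * p + 1) f x" if x: "norm x = 1" for p x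
  proof -
    let ?n = "2 * p + 1"
    have kb: "sphere_bm (\<lambda>z. zker ?n z x)"
    proof -
      have "(\<lambda>z. zker ?n z x) = zker ?n x" by (rule ext) (rule zker_commute)
      then show ?thesis using sphere_bm_zker[OF d2, of ?n x] by (simp only:)
    qed
    note km [measurable] = sphere_bmD[OF kb]
    let ?s = "\<lambda>b z. 2 * (if z \<bullet> b \<ge> 0 then 1 else 0) - 1 :: real"
    let ?g = "\<lambda>b z. ?s b z / fX z * zker ?n z x"
    note [measurable] = measurable_inner_sphere_pair
    have g: "(\<lambda>p. ?g (fst p) (snd p)) \<in> borel_measurable (sphere_measure \<Otimes>\<^sub>M sphere_measure)"
      by measurable
    have "T p x = expectation (\<lambda>\<omega>. ?g (\<beta> \<omega>) (X \<omega>))"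
      unfolding T_def
    proof (rule Bochner_Integration.integral_cong[OF refl])
      fix \<omega> assume "\<omega> \<in> space M"
      then have "norm (X \<omega>) = 1" using measurable_space[OF Xm] by simp
      then show "(2 * (if X \<omega> \<bullet> \<beta> \<omega> \<ge> 0 then 1 else 0) - 1) / fX (X \<omega>) * qker ?n CARD('n) (X \<omega>) x = ?g (\<beta> \<omega>) (X \<omega>)"
        by (simp add: qker_eq_zker[OF d2 _ x])
    qed
    also have "\<dots> = (\<integral>z. (\<integral>b. f\<beta> b * fX z * ?g b z \<partial>sphere_measure) \<partial>sphere_measure)"
    proof (rule expectation_indep_sphere[OF indep f\<beta>_nonneg f\<beta>_dist fX_nonneg fX_dist g])
      \<comment> \<open>The product of \<open>fX\<close> with its reciprocal is 1, or 0 where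
        \<open>fX\<close> vanishes since division by zero yields 0. The sign has modulus one, so
        this function without \<open>fX\<close> dominates.\<close>
      have "integrable (sphere_measure \<Otimes>\<^sub>M sphere_measure) (\<lambda>p. f\<beta> (fst p) * zker ?n (snd p) x)"
        by (rule sphere_integrable_prod[OF i\<beta>(1) sphere_bm_integrable[OF kb]])
      then show "integrable (sphere_measure \<Otimes>\<^sub>M sphere_measure) (\<lambda>p. f\<beta> (fst p) * fX (snd p) * ?g (fst p) (snd p))"
      proof (rule Bochner_Integration.integrable_bound)
        have "(\<lambda>p. f\<beta> (fst p) * fX (snd p)) \<in> borel_measurable (sphere_measure \<Otimes>\<^sub>M sphere_measure)"
          by measurable
        then show "(\<lambda>p. f\<beta> (fst p) * fX (snd p) * ?g (fst p) (snd p)) \<in> borel_measurable (sphere_measure \<Otimes>\<^sub>M sphere_measure)"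
          using g by (rule borel_measurable_times)
      qed (auto simp: abs_mult)
    qed
    also have "\<dots> = (\<integral>z. (if fX z = 0 then 0 else 2 * (f z * zker ?n z x)) \<partial>sphere_measure)"
    proof (rule Bochner_Integration.integral_cong[OF refl])
      fix z :: "real^'n"
      show "(\<integral>b. f\<beta> b * fX z * ?g b z \<partial>sphere_measure) = (if fX z = 0 then 0 else 2 * (f z * zker ?n z x))"
      proof (cases "fX z = 0")
        case False
        then have "f\<beta> b * fX z * ?g b z = (2 * (if z \<bullet> b \<ge> 0 then f\<beta> b else 0) - f\<beta> b) * zker ?n z x" for b
          by simp
        \<comment> \<open>The mean of the sign is 2 H - 1, because \<open>f\<beta>\<close> has
          integral 1.\<close>
        moreover have "(\<integral>b. 2 * (if z \<bullet> b \<ge> 0 then f\<beta> b else 0) - f\<beta> b \<partial>sphere_measure) = 2 * f z"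
          using integrable_halfspace_if[OF i\<beta>(1), of z] i\<beta> by (simp add: f_def H_def hemi_integral_def)
        ultimately show ?thesis using False by (simp only: integral_mult_left_zero) simp
      qed simp
    qed
    \<comment> \<open>Up to a null set, the zeros of \<open>fX\<close> are exactly the points
      outside the hemisphere.\<close>
    also have "\<dots> = (\<integral>z. 2 * (indicator (hemi e) z * (f z * zker ?n z x)) \<partial>sphere_measure)"
    proof (rule integral_cong_AE)
      show "AE z in sphere_measure. (if fX z = 0 then 0 else 2 * (f z * zker ?n z x)) = 2 * (indicator (hemi e) z * (f z * zker ?n z x))"
        using fX_pos by eventually_elim (auto simp: indicator_def dest: fX_zero)
    qed measurable
    \<comment> \<open>The product of two odd functions is even, so the hemisphere carries half of
      the integral; this absorbs the factor 2.\<close>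
    also have "\<dots> = (\<integral>z. f z * zker ?n z x \<partial>sphere_measure)"
      unfolding integral_mult_right_zero
    proof (rule integral_even_hemi)
      show "integrable sphere_measure (\<lambda>z. f z * zker ?n z x)"
        by (intro sphere_bm_integrable sphere_bm_mult fb kb)
      fix z :: "real^'n" assume "norm z = 1"
      then show "f (- z) * zker ?n (- z) x = f z * zker ?n z x"
        by (simp add: f_minus zker_commute[of _ _ x] zker_uminus[OF d2])
    qed
    also have "\<dots> = zproj ?n f x"
      by (simp add: zproj_def zker_commute[of _ _ x] mult.commute)
    finally show ?thesis .
  qed

  \<comment> \<open>With the even degrees gone, N terms of the stated series are 2N terms of the
    full expansion, so completeness is applied along a subsequence.\<close>
  have zsum: "(\<Sum>n<2 * N. zproj n f x) = (\<Sum>p<N. zproj (2 * p + 1) f x)" for N x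
  proof (induction N)
    case (Suc N)
    have "zproj (2 * N) f x = 0"
      by (rule zproj_parity[OF d2 fm]) (simp add: f_minus)
    with Suc show ?case by simp
  qed simp
  have "(\<lambda>N. \<integral>x. (f x - (\<Sum>n<2 * N. zproj n f x))\<^sup>2 \<partial>sphere_measure) \<longlonglongrightarrow> 0"
    using LIMSEQ_subseq_LIMSEQ[OF zproj_complete[OF d2 fc], of "\<lambda>N. 2 * N"]
    by (simp add: strict_mono_def o_def)
  then have "(\<lambda>N. ennreal (\<integral>x. (f x - (\<Sum>n<2 * N. zproj n f x))\<^sup>2 \<partial>sphere_measure)) \<longlonglongrightarrow> ennreal 0"
    by (rule tendsto_ennrealI)
  moreover have "(\<integral>\<^sup>+ x. ennreal ((1/2 + (\<Sum>p<N. T p x) - R x)\<^sup>2) \<partial>sphere_measure)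
     = ennreal (\<integral>x. (f x - (\<Sum>n<2 * N. zproj n f x))\<^sup>2 \<partial>sphere_measure)" for N
  proof -
    have "(\<integral>\<^sup>+ x. ennreal ((1/2 + (\<Sum>p<N. T p x) - R x)\<^sup>2) \<partial>sphere_measure)
      = (\<integral>\<^sup>+ x. ennreal ((f x - (\<Sum>n<2 * N. zproj n f x))\<^sup>2) \<partial>sphere_measure)"
    proof (rule nn_integral_cong_AE, rule AE_mp[OF RH AE_I2], intro impI)
      fix x :: "real^'n" assume "x \<in> space sphere_measure" and R: "R x = H x"
      then have "norm x = 1" by simp
      then have "1/2 + (\<Sum>p<N. T p x) - R x = - (f x - (\<Sum>n<2 * N. zproj n f x))"
        unfolding R zsum by (simp add: TQ f_def)
      then show "ennreal ((1/2 + (\<Sum>p<N. T p x) - R x)\<^sup>2) = ennreal ((f x - (\<Sum>n<2 * N. zproj n f x))\<^sup>2)"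
        by (simp only: power2_minus)
    qed
    also have "\<dots> = ennreal (\<integral>x. (f x - (\<Sum>n<2 * N. zproj n f x))\<^sup>2 \<partial>sphere_measure)"
      unfolding power2_eq_square
      by (rule nn_integral_eq_integral)
         (auto intro!: sphere_bm_integrable sphere_bm_mult sphere_bm_diff sphere_bm_sum sphere_bm_zproj d2 fb)
    finally show ?thesis .
  qed
  ultimately show ?thesis using TQ QR by simp
qed

end
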